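(* The function $$u=\ln\bigl(t+b(z)\bigr)+\ln\bigl(t+\bar b(\bar z)\bigr)-2\ln(z+\bar z)$$ is a solution of the heavenly equation $u_{z\bar z}=\kappa(e^u)_{tt}$ with $\kappa=+1$ for an arbitrary holomorphic function $b(z)$. This solution is a non-invariant solution of this equation if and only if $b(z)$ does not coincide with any of the following choices: 1. $b(z)=C\left(\dfrac{z+\lambda-\nu}{z+\lambda+\nu}\right)^{\gamma}+\dfrac{\alpha}{\beta}$, where $\alpha,\beta$ are arbitrary real constants, $\beta\neq0$, $$\nu=\sqrt{-\frac{C_2}{C_1}},\qquad \gamma=\frac{\beta}{2\sqrt{-C_1C_2}},$$ and $\lambda,C_1,C_2$ are complex constants with $\bar\lambda=-\lambda$, $\bar C_1=-C_1$, $\bar C_2=-C_2$, $C_1\neq0$, $C_2\neq0$. In this case the solution is invariant with respect to the symmetry generator $$X=\alpha\partial_t+\beta(t\partial_t+2\partial_u)+C_1\bigl[(z+\lambda)^2\partial_z-(\bar z-\lambda)^2\partial_{\bar z}-2(z-\bar z+2\lambda)\partial_u\bigr]+C_2(\partial_z-\partial_{\bar z}).$$ 2. $b(z)=\dfrac{\alpha}{2\sqrt{-C_1C_2}}\ln\left(\dfrac{z+\lambda+\nu}{z+\lambda-\nu}\right)+C$ if $\beta=0$, $C_2\neq0$; the solution is invariant with respect to the previous generator $X$ with $\beta=0$. 3. $b(z)=C\exp\left[-\dfrac{\beta}{C_1(z+\lambda)}\right]+\dfrac{\alpha}{\beta}$ if $C_2=0$, $\beta\neq0$; the solution is invariant with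 respect to $X$ from case 1 with $C_2=0$. 4. $b(z)=\dfrac{\alpha}{C_1(z+\lambda)}+C$ if $\beta=0$ and $C_2=0$; the solution is invariant with respect to $X$ from case 1 with $\beta=0$ and $C_2=0$. 5. $b(z)=C(C_1z+C_2)^{\beta/C_1}+\dfrac{\alpha}{\beta}$ if $C_1\neq0$, $\beta\neq0$; the solution is invariant with respect to $$X=\alpha\partial_t+\beta(t\partial_t+2\partial_u)+C_1(z\partial_z+\bar z\partial_{\bar z}-2\partial_u)+C_2(\partial_z-\partial_{\bar z}).$$ 6. $b(z)=Ce^{\frac{\beta}{C_2}z}+\dfrac{\alpha}{\beta}$ if $C_1=0$, $\beta\neq0$; the solution is invariant with respect to $X$ from case 5 with $C_1=0$. 7. $b(z)=-\dfrac{\alpha}{C_2}z+C$ if $C_1=0$, $\beta=0$; the solution is invariant with respect to $X$ from case 5 with $C_1=0$ and $\beta=0$. 8. $b(z)=b=\text{constant}$ if $C_1=\alpha=\beta=0$, $C_2\neq0$; the solution is invariant with respect to $X=\partial_z-\partial_{\bar z}$. If $b=\alpha/\beta$, then this solution is also invariant with respect to $X=\alpha\partial_t+\beta(t\partial_t+2\partial_u)$.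
   Context: Here $z,\bar z$ are complex conjugate variables, $t$ is real, $\bar b(\bar z)$ is the complex conjugate of $b(z)$; throughout the list $\alpha,\beta$ are real constants and $C$ is a complex (integration) constant. In cases 2–4 the constants $\lambda,C_1,C_2,\nu$ are as in case 1 except for the changes stated; in cases 5–8 the constants $C_1,C_2$ are those of the linear coefficient $a(z)=C_1z+C_2$, $\bar a(\bar z)=C_1\bar z-C_2$, so that $C_1$ is real and $C_2$ purely imaginary. Formulas are understood with nonzero denominators, and the square roots in case 1 and 2 are chosen consistently, $\sqrt{-C_1C_2}=C_1\nu$. The general generator of a one-parameter point symmetry group of the heavenly equation is $$X=\alpha\partial_t+\beta(t\partial_t+2\partial_u)+a(z)\partial_z+\bar a(\bar z)\partial_{\bar z}-\bigl(a'(z)+\bar a'(\bar z)\bigr)\partial_u,$$ with $\alpha,\beta$ real constants and $a$ holomorphic with complex conjugate $\bar a$ (generators are taken up to a constant factor). A solution $u=f(z,\bar z,t)$ is invariant with respect to $X$ if $$(\alpha+\beta t)f_t+a(z)f_z+\bar a(\bar z)f_{\bar z}=2\beta-a'(z)-\bar a'(\bar z).$$ It is called invariant if this holds for some $\alpha,\beta,a$ not all zero, and non-invariant otherwise.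
   Formalization: A ninth choice is added to the list: b = -(α/C₁) ln(C₁z+C₂) + C for C₁≠0, β=0, invariant under X of case 5 with β=0. Without it the "if and only if" fails: b = ln z gives an invariant solution (α=-1, β=0, a=z) that is none of choices 1–8. *)

theory Defs
  imports "HOL-Complex_Analysis.Complex_Analysis"
begin

text \<open>Functions of \<open>(z, \<bar>z, t)\<close> are functions on \<^typ>\<open>complex \<times> real\<close>;
  \<open>\<partial>\<^sub>z\<close> and \<open>\<partial>\<close> with respect to the conjugate variable are the Wirtinger derivatives.\<close>

primrec C_k_on :: "nat \<Rightarrow> 'a::real_normed_vector set \<Rightarrow> ('a \<Rightarrow> 'b::real_normed_vector) \<Rightarrow> bool" where
  "C_k_on 0 S f \<longleftrightarrow> continuous_on S f"
| "C_k_on (Suc k) S f \<longleftrightarrow>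
     (\<forall>p\<in>S. f differentiable (at p)) \<and> (\<forall>v. C_k_on k S (\<lambda>p. frechet_derivative f (at p) v))"

definition d_t :: "(complex \<times> real \<Rightarrow> complex) \<Rightarrow> complex \<times> real \<Rightarrow> complex" where
  "d_t f p = frechet_derivative f (at p) (0, 1)"

definition d_z :: "(complex \<times> real \<Rightarrow> complex) \<Rightarrow> complex \<times> real \<Rightarrow> complex" where
  "d_z f p = (frechet_derivative f (at p) (1, 0) - \<i> * frechet_derivative f (at p) (\<i>, 0)) / 2"

definition d_zbar :: "(complex \<times> real \<Rightarrow> complex) \<Rightarrow> complex \<times> real \<Rightarrow> complex" where
  "d_zbar f p = (frechet_derivative f (at p) (1, 0) + \<i> * frechet_derivative f (at p) (\<i>, 0)) / 2"

definition heavenly_solution ::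
  "real \<Rightarrow> (complex \<times> real) set \<Rightarrow> (complex \<times> real \<Rightarrow> real) \<Rightarrow> bool" where
  "heavenly_solution \<kappa> \<Omega> u \<longleftrightarrow> open \<Omega> \<and> C_k_on 2 \<Omega> u \<and>
     (\<forall>p\<in>\<Omega>. d_z (d_zbar (\<lambda>q. complex_of_real (u q))) p
            = complex_of_real \<kappa> * d_t (d_t (\<lambda>q. complex_of_real (exp (u q)))) p)"

text \<open>A vector field, given by its coefficients at \<open>\<partial>\<^sub>t\<close>, \<open>\<partial>\<^sub>z\<close>, \<open>\<partial>\<close> with respect to the conjugate
  of \<open>z\<close>, and \<open>\<partial>\<^sub>u\<close>. None of the coefficients needed here depends on \<open>u\<close>.\<close>

datatype vfield = VField
  (coef_t: "complex \<times> real \<Rightarrow> complex") (coef_z: "complex \<times> real \<Rightarrow> complex")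
  (coef_zbar: "complex \<times> real \<Rightarrow> complex") (coef_u: "complex \<times> real \<Rightarrow> complex")

definition scale_vfield :: "complex \<Rightarrow> vfield \<Rightarrow> vfield" where
  "scale_vfield c X = VField (\<lambda>p. c * coef_t X p) (\<lambda>p. c * coef_z X p)
     (\<lambda>p. c * coef_zbar X p) (\<lambda>p. c * coef_u X p)"

definition generator :: "real \<Rightarrow> real \<Rightarrow> (complex \<Rightarrow> complex) \<Rightarrow> vfield" where
  "generator \<alpha> \<beta> a = VField
     (\<lambda>(z, t). of_real (\<alpha> + \<beta> * t))
     (\<lambda>(z, t). a z)
     (\<lambda>(z, t). cnj (a z))
     (\<lambda>(z, t). 2 * of_real \<beta> - (deriv a z + cnj (deriv a z)))"

definition admissible_generator :: "complex set \<Rightarrow> real \<Rightarrow> real \<Rightarrow> (complex \<Rightarrow> complex) \<Rightarrow> bool" where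
  "admissible_generator D \<alpha> \<beta> a \<longleftrightarrow>
     a holomorphic_on D \<and> (\<alpha> \<noteq> 0 \<or> \<beta> \<noteq> 0 \<or> (\<exists>z\<in>D. a z \<noteq> 0))"

text \<open>The generators are taken up to a constant factor, which may be complex: the field
  \<open>\<partial>\<^sub>z\<close> minus its conjugate is of the form \<^const>\<open>generator\<close> only after multiplication by \<open>\<i>\<close>.\<close>

definition symmetry_generator :: "complex set \<Rightarrow> vfield \<Rightarrow> bool" where
  "symmetry_generator D X \<longleftrightarrow>
     (\<exists>\<alpha> \<beta> a c. admissible_generator D \<alpha> \<beta> a \<and> c \<noteq> 0 \<and> X = scale_vfield c (generator \<alpha> \<beta> a))"

definition invariant_under :: "(complex \<times> real) set \<Rightarrow> (complex \<times> real \<Rightarrow> real) \<Rightarrow> vfield \<Rightarrow> bool" where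
  "invariant_under \<Omega> u X \<longleftrightarrow>
     (\<forall>p\<in>\<Omega>. coef_t X p * d_t (\<lambda>q. complex_of_real (u q)) p
           + coef_z X p * d_z (\<lambda>q. complex_of_real (u q)) p
           + coef_zbar X p * d_zbar (\<lambda>q. complex_of_real (u q)) p = coef_u X p)"

definition invariant_solution ::
  "real \<Rightarrow> (complex \<times> real) set \<Rightarrow> (complex \<times> real \<Rightarrow> real) \<Rightarrow> bool" where
  "invariant_solution \<kappa> \<Omega> u \<longleftrightarrow> heavenly_solution \<kappa> \<Omega> u \<and>
     (\<exists>\<alpha> \<beta> a. admissible_generator (fst ` \<Omega>) \<alpha> \<beta> a \<and> invariant_under \<Omega> u (generator \<alpha> \<beta> a))"

definition noninvariant_solution ::
  "real \<Rightarrow> (complex \<times> real) set \<Rightarrow> (complex \<times> real \<Rightarrow> real) \<Rightarrow> bool" where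
  "noninvariant_solution \<kappa> \<Omega> u \<longleftrightarrow> heavenly_solution \<kappa> \<Omega> u \<and> \<not> invariant_solution \<kappa> \<Omega> u"

definition invariant_under_symmetry ::
  "(complex \<times> real) set \<Rightarrow> (complex \<times> real \<Rightarrow> real) \<Rightarrow> vfield \<Rightarrow> bool" where
  "invariant_under_symmetry \<Omega> u X \<longleftrightarrow> symmetry_generator (fst ` \<Omega>) X \<and> invariant_under \<Omega> u X"

definition u_dom :: "complex set \<Rightarrow> (complex \<Rightarrow> complex) \<Rightarrow> (complex \<times> real) set" where
  "u_dom D b = {(z, t). z \<in> D \<and> of_real t + b z \<noteq> 0}"

text \<open>The logarithms of \<open>t + b(z)\<close> and of its conjugate are meant to be conjugate to each other, so that
  the sum is real. With principal branches it is real up to multiples of \<open>2\<pi>\<i>\<close>, which occur only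
  where an argument lies on the negative real axis; \<^const>\<open>Re\<close> removes them.\<close>

definition u_sol :: "(complex \<Rightarrow> complex) \<Rightarrow> complex \<times> real \<Rightarrow> real" where
  "u_sol b = (\<lambda>(z, t). Re (Ln (of_real t + b z) + Ln (of_real t + cnj (b z)) - 2 * Ln (z + cnj z)))"

text \<open>The real forms of \<open>a(z) = C\<^sub>1(z+lam)\<^sup>2 + C\<^sub>2\<close> (with \<open>C\<^sub>1\<close>, \<open>C\<^sub>2\<close>, \<open>lam\<close> imaginary) and of
  \<open>a(z) = C\<^sub>1z + C\<^sub>2\<close> (with \<open>C\<^sub>1\<close> real, \<open>C\<^sub>2\<close> imaginary).\<close>

definition X_quadratic :: "real \<Rightarrow> real \<Rightarrow> complex \<Rightarrow> complex \<Rightarrow> complex \<Rightarrow> vfield" where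
  "X_quadratic \<alpha> \<beta> lam C1 C2 = VField
     (\<lambda>(z, t). of_real (\<alpha> + \<beta> * t))
     (\<lambda>(z, t). C1 * (z + lam)^2 + C2)
     (\<lambda>(z, t). - C1 * (cnj z - lam)^2 - C2)
     (\<lambda>(z, t). 2 * of_real \<beta> - 2 * C1 * (z - cnj z + 2 * lam))"

definition X_linear :: "real \<Rightarrow> real \<Rightarrow> real \<Rightarrow> complex \<Rightarrow> vfield" where
  "X_linear \<alpha> \<beta> C1 C2 = VField
     (\<lambda>(z, t). of_real (\<alpha> + \<beta> * t))
     (\<lambda>(z, t). of_real C1 * z + C2)
     (\<lambda>(z, t). of_real C1 * cnj z - C2)
     (\<lambda>(z, t). 2 * of_real \<beta> - 2 * of_real C1)"

definition X_shift :: vfield where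
  "X_shift = VField (\<lambda>p. 0) (\<lambda>p. 1) (\<lambda>p. - 1) (\<lambda>p. 0)"

definition log_branch :: "complex set \<Rightarrow> (complex \<Rightarrow> complex) \<Rightarrow> (complex \<Rightarrow> complex) \<Rightarrow> bool" where
  "log_branch D q L \<longleftrightarrow> L holomorphic_on D \<and> (\<forall>z\<in>D. exp (L z) = q z)"

definition imaginary :: "complex \<Rightarrow> bool" where
  "imaginary c \<longleftrightarrow> cnj c = - c"

text \<open>In the next two definitions \<open>\<nu>\<close> is either square root of \<open>-C\<^sub>2/C\<^sub>1\<close>, and \<open>C\<^sub>1\<nu>\<close> is
  the corresponding square root of \<open>-C\<^sub>1C\<^sub>2\<close>.\<close>

definition b_power_quadratic where
  "b_power_quadratic D b (\<alpha>::real) (\<beta>::real) lam C1 C2 \<nu> C \<longleftrightarrow>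
     imaginary lam \<and> imaginary C1 \<and> imaginary C2 \<and> C1 \<noteq> 0 \<and> C2 \<noteq> 0 \<and> \<beta> \<noteq> 0 \<and> \<nu>^2 = - C2 / C1 \<and>
     (\<exists>L. log_branch D (\<lambda>z. (z + lam - \<nu>) / (z + lam + \<nu>)) L \<and>
        (\<forall>z\<in>D. b z = C * exp (of_real \<beta> / (2 * (C1 * \<nu>)) * L z) + of_real (\<alpha> / \<beta>)))"

definition b_log_quadratic where
  "b_log_quadratic D b (\<alpha>::real) lam C1 C2 \<nu> C \<longleftrightarrow>
     imaginary lam \<and> imaginary C1 \<and> imaginary C2 \<and> C1 \<noteq> 0 \<and> C2 \<noteq> 0 \<and> \<nu>^2 = - C2 / C1 \<and>
     (\<exists>L. log_branch D (\<lambda>z. (z + lam + \<nu>) / (z + lam - \<nu>)) L \<and>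
        (\<forall>z\<in>D. b z = of_real \<alpha> / (2 * (C1 * \<nu>)) * L z + C))"

definition b_exp_pole where
  "b_exp_pole D b (\<alpha>::real) (\<beta>::real) lam C1 C \<longleftrightarrow>
     imaginary lam \<and> imaginary C1 \<and> C1 \<noteq> 0 \<and> \<beta> \<noteq> 0 \<and>
     (\<forall>z\<in>D. b z = C * exp (- (of_real \<beta> / (C1 * (z + lam)))) + of_real (\<alpha> / \<beta>))"

definition b_pole where
  "b_pole D b (\<alpha>::real) lam C1 C \<longleftrightarrow>
     imaginary lam \<and> imaginary C1 \<and> C1 \<noteq> 0 \<and>
     (\<forall>z\<in>D. b z = of_real \<alpha> / (C1 * (z + lam)) + C)"

definition b_power_linear where
  "b_power_linear D b (\<alpha>::real) (\<beta>::real) (C1::real) C2 C \<longleftrightarrow>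
     imaginary C2 \<and> C1 \<noteq> 0 \<and> \<beta> \<noteq> 0 \<and>
     (\<exists>L. log_branch D (\<lambda>z. of_real C1 * z + C2) L \<and>
        (\<forall>z\<in>D. b z = C * exp (of_real (\<beta> / C1) * L z) + of_real (\<alpha> / \<beta>)))"

text \<open>The solution of \<open>a b' = \<beta>b - \<alpha>\<close> for \<open>a(z) = C\<^sub>1z + C\<^sub>2\<close>, \<open>C\<^sub>1 \<noteq> 0\<close>, \<open>\<beta> = 0\<close>. It is needed for
  the classification to be complete: for \<open>b = ln\<close> on the right half-plane the solution is invariant
  under \<open>a(z) = z\<close>, \<open>\<alpha> = -1\<close>, \<open>\<beta> = 0\<close>, and this \<open>b\<close> has none of the other forms.\<close>

definition b_log_linear where
  "b_log_linear D b (\<alpha>::real) (C1::real) C2 C \<longleftrightarrow>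
     imaginary C2 \<and> C1 \<noteq> 0 \<and>
     (\<exists>L. log_branch D (\<lambda>z. of_real C1 * z + C2) L \<and>
        (\<forall>z\<in>D. b z = - of_real (\<alpha> / C1) * L z + C))"

definition b_exp where
  "b_exp D b (\<alpha>::real) (\<beta>::real) C2 C \<longleftrightarrow>
     imaginary C2 \<and> C2 \<noteq> 0 \<and> \<beta> \<noteq> 0 \<and>
     (\<forall>z\<in>D. b z = C * exp (of_real \<beta> / C2 * z) + of_real (\<alpha> / \<beta>))"

definition b_affine where
  "b_affine D b (\<alpha>::real) C2 C \<longleftrightarrow>
     imaginary C2 \<and> C2 \<noteq> 0 \<and> (\<forall>z\<in>D. b z = - (of_real \<alpha> / C2) * z + C)"

definition b_const :: "complex set \<Rightarrow> (complex \<Rightarrow> complex) \<Rightarrow> complex \<Rightarrow> bool" where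
  "b_const D b c \<longleftrightarrow> (\<forall>z\<in>D. b z = c)"

end

theory Submission
  imports Defs
begin

text \<open>The invariance condition under \<open>generator \<alpha> \<beta> a\<close> has the form \<open>Re (F/(t + b)) = K\<close> with
  \<open>F = \<alpha> - \<beta>b + ab'\<close> and \<open>K = Re a / Re z - Re a'\<close> independent of \<open>t\<close>. Varying \<open>t\<close> gives \<open>K = 0\<close>,
  \<open>Re F = 0\<close> and \<open>Im F \<cdot> Im b = 0\<close>, whence \<open>F = 0\<close>. Differentiating \<open>Re a = Re z \<cdot> Re a'\<close> in the real
  direction gives \<open>Re a'' = 0\<close>, so \<open>a\<close> is a quadratic polynomial with imaginary leading and constant and
  real linear coefficient, and it remains to solve \<open>ab' = \<beta>b - \<alpha>\<close>.
  As \<open>D\<close> need not be simply connected and may contain zeros of \<open>a\<close>, the logarithms in the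
  solutions are not automatic.\<close>

text \<open>A holomorphic function with zero real part is locally constant, so \<open>F\<close> is
  an imaginary constant. If it were nonzero, \<open>b\<close> would be real-valued, hence constant,
  and \<open>F\<close> = \<alpha> - \<beta> \<open>b\<close> would be real, a contradiction. The
  obstacle is the single-valued logarithm. A connected \<open>D\<close> that misses the imaginary
  axis lies in an open half-plane, so zeros of \<open>a\<close> on the axis are harmless even when
  \<open>D\<close> has holes. This settles linear \<open>a\<close> and quadratic \<open>a\<close>
  with imaginary \<nu>. For real \<nu> exactly one of the zeros \<open>-lam\<close> \<plusminus>
  \<nu> lies in that half-plane, and \<open>D\<close> may surround or contain it. The branch must
  then be extracted from \<open>b\<close>: for \<beta> = 0 the function \<open>b\<close> is itself
  the logarithm up to an affine change, and for \<beta> \<noteq> 0 the argument is read off from the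
  modulus of \<open>b\<close> - \<alpha>/\<beta>. A constant \<open>b\<close> carries no such
  information, so constants are split off before the integration.\<close>

section \<open>Real parts and moduli of complex functions\<close>

text \<open>\<open>ln (cmod f)\<close> is the real part of any local logarithm of \<open>f\<close>,
  whence the logarithmic derivative. Computing with half the logarithm of the squared modulus avoids
  choosing a branch.\<close>

lemma has_derivative_ln_cmod:
  assumes f: "(f has_derivative f') (at x within S)" and nz: "f x \<noteq> 0"
  shows "((\<lambda>x. ln (cmod (f x))) has_derivative (\<lambda>v. Re (f' v / f x))) (at x within S)"
proof -
  have pos: "(Re (f x))\<^sup>2 + (Im (f x))\<^sup>2 > 0"
    using nz by (metis cmod_power2 norm_eq_zero zero_less_power2)
  have sq: "((\<lambda>x. (Re (f x))\<^sup>2 + (Im (f x))\<^sup>2) has_derivative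
     (\<lambda>v. 2 * Re (f x) * Re (f' v) + 2 * Im (f x) * Im (f' v))) (at x within S)"
    by (rule has_derivative_eq_rhs[OF has_derivative_add[OF has_derivative_power[OF has_derivative_Re[OF f]]
          has_derivative_power[OF has_derivative_Im[OF f]]]]) (simp add: fun_eq_iff ac_simps)
  have scale: "1 / 2 * ((2 * x * p + 2 * y * q) * inverse N) = (p * x + q * y) / N" for x y p q N :: real
    by (cases "N = 0") (simp_all add: field_simps)
  from has_derivative_mult_right[OF has_derivative_ln[OF pos sq], of "1 / 2"]
  have "((\<lambda>x. 1 / 2 * ln ((Re (f x))\<^sup>2 + (Im (f x))\<^sup>2)) has_derivative (\<lambda>v. Re (f' v / f x))) (at x within S)"
    by (rule has_derivative_eq_rhs)
       (simp only: fun_eq_iff Re_divide scale, simp)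
  \<comment> \<open>Stated for all \<open>z\<close>, so that the two functions can be exchanged
    under the derivative; at \<open>z = 0\<close> it rests on the convention
    \<open>ln 0 = 0\<close>.\<close>
  moreover have "1 / 2 * ln ((Re z)\<^sup>2 + (Im z)\<^sup>2) = ln (cmod z)" for z
    by (cases "z = 0") (simp_all add: ln_realpow flip: cmod_power2)
  ultimately show ?thesis by simp
qed

lemma imaginary_iff_Re: "imaginary c \<longleftrightarrow> Re c = 0"
  by (auto simp: imaginary_def complex_eq_iff)

text \<open>The real differential of \<open>Re f\<close> sends \<open>h\<close> to
  \<open>Re (deriv f z * h)\<close>; in the direction \<open>h = cnj (deriv f z)\<close> this is the
  squared modulus of the derivative.\<close>

lemma Re_zero_imp_deriv_zero:
  assumes "open D" "f holomorphic_on D" "\<And>z. z \<in> D \<Longrightarrow> Re (f z) = 0" "z \<in> D"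
  shows "deriv f z = 0"
proof -
  have "(f has_derivative (\<lambda>h. deriv f z * h)) (at z)"
    using holomorphic_derivI[OF assms(2,1,4)] by (simp add: has_field_derivative_def)
  then have "((\<lambda>z. Re (f z)) has_derivative (\<lambda>h. Re (deriv f z * h))) (at z)"
    by (rule has_derivative_Re)
  moreover have "((\<lambda>z. Re (f z)) has_derivative (\<lambda>h. 0)) (at z)"
    by (rule has_derivative_transform_within_open[OF has_derivative_const[of 0] assms(1,4)])
       (simp add: assms(3))
  ultimately have "(\<lambda>h. Re (deriv f z * h)) = (\<lambda>h. 0)"
    by (rule has_derivative_unique)
  from fun_cong[OF this, of "cnj (deriv f z)"] have "Re (deriv f z * cnj (deriv f z)) = 0" .
  then show ?thesis
    by (simp add: complex_mult_cnj complex_eq_iff flip: power2_eq_square)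
qed

lemma deriv_zero_constant:
  fixes f :: "complex \<Rightarrow> complex"
  assumes "open D" "connected D" "\<And>z. z \<in> D \<Longrightarrow> (f has_field_derivative 0) (at z)"
  shows "\<exists>C. \<forall>z\<in>D. f z = C"
proof -
  have "f constant_on D" by (rule has_field_derivative_0_imp_constant_on) (use assms in auto)
  then show ?thesis unfolding constant_on_def .
qed

lemma quadratic_of_real_part_identity:
  assumes D: "open D" "connected D" "D \<noteq> {}" and Re: "\<And>z. z \<in> D \<Longrightarrow> Re z \<noteq> 0"
    and a: "a holomorphic_on D" and eq: "\<And>z. z \<in> D \<Longrightarrow> Re (a z) = Re z * Re (deriv a z)"
  obtains A E G where "imaginary A" "imaginary G" "\<forall>z\<in>D. a z = A * z\<^sup>2 + of_real E * z + G"
proof -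
  have a': "deriv a holomorphic_on D" and a'': "deriv (deriv a) holomorphic_on D"
    by (intro holomorphic_deriv a D)+
  note der = holomorphic_derivI[OF a D(1), where T = UNIV] holomorphic_derivI[OF a' D(1), where T = UNIV] holomorphic_derivI[OF a'' D(1), where T = UNIV]
  have re0: "Re (deriv (deriv a) z) = 0" if z: "z \<in> D" for z
  proof -
    have "((\<lambda>z. Re (a z) - Re z * Re (deriv a z)) has_derivative
      (\<lambda>h. Re (deriv a z * h) - (Re z * Re (deriv (deriv a) z * h) + Re h * Re (deriv a z)))) (at z)"
      using der(1,2)[OF z]
      by (intro has_derivative_diff has_derivative_mult has_derivative_Re has_derivative_ident)
         (simp_all add: has_field_derivative_def)
    moreover have "((\<lambda>z. Re (a z) - Re z * Re (deriv a z)) has_derivative (\<lambda>h. 0)) (at z)"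
      by (rule has_derivative_transform_within_open[OF has_derivative_const[of 0] D(1) z])
         (simp add: eq)
    ultimately have "(\<lambda>h. Re (deriv a z * h) - (Re z * Re (deriv (deriv a) z * h) + Re h * Re (deriv a z))) = (\<lambda>h. 0)"
      by (rule has_derivative_unique)
    \<comment> \<open>In the direction 1 the two terms \<open>Re (deriv a z)\<close> cancel and
      \<open>Re z * Re (deriv (deriv a) z) = 0\<close> remains.\<close>
    from fun_cong[OF this, of 1] show ?thesis using Re[OF z] by simp
  qed
  have "(deriv (deriv a) has_field_derivative 0) (at z)" if "z \<in> D" for z
  proof -
    have "deriv (deriv (deriv a)) z = 0"
      by (rule Re_zero_imp_deriv_zero[OF D(1) a'' _ that]) (rule re0)
    then show ?thesis using der(3)[OF that] by (simp only:)
  qed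
  then obtain K where K: "\<And>z. z \<in> D \<Longrightarrow> deriv (deriv a) z = K"
    using deriv_zero_constant[OF D(1,2), of "\<lambda>z. deriv (deriv a) z"] by blast
  have "((\<lambda>z. deriv a z - K * z) has_field_derivative 0) (at z)" if "z \<in> D" for z
    by (rule derivative_eq_intros der(2)[OF that] refl)+ (simp add: K that)
  then obtain E where E: "\<And>z. z \<in> D \<Longrightarrow> deriv a z - K * z = E"
    using deriv_zero_constant[OF D(1,2), of "\<lambda>z. deriv a z - K * z"] by blast
  have E': "deriv a z = K * z + E" if "z \<in> D" for z using E[OF that] by (simp add: algebra_simps)
  have "((\<lambda>z. a z - K / 2 * z\<^sup>2 - E * z) has_field_derivative 0) (at z)" if "z \<in> D" for z
    by (rule derivative_eq_intros der(1)[OF that] refl)+ (simp add: E' that)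
  then obtain G where "\<And>z. z \<in> D \<Longrightarrow> a z - K / 2 * z\<^sup>2 - E * z = G"
    using deriv_zero_constant[OF D(1,2), of "\<lambda>z. a z - K / 2 * z\<^sup>2 - E * z"] by blast
  then have G: "a z = K / 2 * z\<^sup>2 + E * z + G" if "z \<in> D" for z
    using that by (auto simp: algebra_simps)
  obtain z0 where z0: "z0 \<in> D" using D by blast
  then have ReK: "Re K = 0" using re0 K by metis
  \<comment> \<open>Since \<open>K\<close> is imaginary, the quadratic contributions to both sides
    of the identity agree, and so do those of \<open>Re E\<close>.\<close>
  have lin: "Im E * Im z = Re G" if "z \<in> D" for z
  proof -
    have "Re (K / 2 * z\<^sup>2 + E * z + G) = Re z * Re (K * z + E)"
      using eq[OF that] G[OF that] E'[OF that] by simp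
    then show ?thesis using ReK by (simp add: power2_eq_square algebra_simps)
  qed
  obtain e where e: "e > 0" "cball z0 e \<subseteq> D" using D(1) z0 open_contains_cball by blast
  \<comment> \<open>A vertical displacement changes only \<open>Im z\<close> in \<open>lin\<close>,
    which forces \<open>Im E = 0\<close> and then \<open>Re G = 0\<close>.\<close>
  have "z0 + \<i> * of_real e \<in> D" using e by (auto simp: dist_norm norm_mult subset_iff)
  then have "Im E * (Im z0 + e) = Re G" using lin by fastforce
  then have "Im E * e = 0" using lin[OF z0] by (simp add: algebra_simps)
  then have ImE: "Im E = 0" using e by simp
  then have "Re G = 0" using lin[OF z0] by simp
  moreover have "E = of_real (Re E)" using ImE by (simp add: complex_eq_iff)
  ultimately show thesis
    using that[of "K / 2" G "Re E"] ReK G by (simp add: imaginary_iff_Re)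
qed

section \<open>Linear first-order equations and branches of the logarithm\<close>

lemma constant_difference:
  assumes "open D" "connected D"
    and "\<And>z. z \<in> D \<Longrightarrow> (f has_field_derivative f' z) (at z)"
    and "\<And>z. z \<in> D \<Longrightarrow> (g has_field_derivative f' z) (at z)"
  obtains C :: complex where "\<forall>z\<in>D. f z = g z + C"
proof -
  have "((\<lambda>z. f z - g z) has_field_derivative 0) (at z)" if "z \<in> D" for z
    using DERIV_diff[OF assms(3,4)[OF that]] by simp
  then obtain C where "\<And>z. z \<in> D \<Longrightarrow> f z - g z = C"
    using deriv_zero_constant[OF assms(1,2), of "\<lambda>z. f z - g z"] by blast
  then have "\<forall>z\<in>D. f z = g z + C" by (auto simp: algebra_simps)
  then show thesis by (rule that)
qed

text \<open>Integrating factor \<open>exp (- M)\<close>. The primitive \<open>M\<close> of the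
  coefficient is supplied from outside because it need not exist on a domain with holes.\<close>

lemma linear_ode_solution:
  assumes "open D" "connected D"
    and "\<And>z. z \<in> D \<Longrightarrow> (M has_field_derivative m z) (at z)"
    and "\<And>z. z \<in> D \<Longrightarrow> (h has_field_derivative m z * h z) (at z)"
  obtains C :: complex where "\<forall>z\<in>D. h z = C * exp (M z)"
proof -
  have "((\<lambda>z. h z * exp (- M z)) has_field_derivative 0) (at z)" if "z \<in> D" for z
    by (rule derivative_eq_intros assms(3,4)[OF that] refl)+ (simp add: algebra_simps)
  then obtain C where "\<And>z. z \<in> D \<Longrightarrow> h z * exp (- M z) = C"
    using deriv_zero_constant[OF assms(1,2), of "\<lambda>z. h z * exp (- M z)"] by blast
  then have "\<forall>z\<in>D. h z = C * exp (M z)" by (auto simp: exp_minus field_simps)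
  then show thesis by (rule that)
qed

text \<open>\<open>r\<close> solves the linear equation satisfied by \<open>exp L\<close>, so the
  two are proportional, and the nonzero factor is absorbed into the additive constant
  \<open>K\<close>.\<close>

lemma log_branch_of_logarithmic_derivative:
  assumes D: "open D" "connected D" "D \<noteq> {}"
    and r: "\<And>z. z \<in> D \<Longrightarrow> (r has_field_derivative r' z) (at z)" "\<And>z. z \<in> D \<Longrightarrow> r z \<noteq> 0"
    and L: "\<And>z. z \<in> D \<Longrightarrow> (L has_field_derivative r' z / r z) (at z)"
  obtains K where "log_branch D r (\<lambda>z. L z + K)"
proof -
  have r_eq: "(r has_field_derivative r' z / r z * r z) (at z)" if "z \<in> D" for z
    using r[OF that] by simp
  obtain C where C: "\<forall>z\<in>D. r z = C * exp (L z)"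
    by (rule linear_ode_solution[OF D(1,2) L r_eq])
  have "C \<noteq> 0" using C r(2) D(3) by fastforce
  then have "exp (L z + Ln C) = r z" if "z \<in> D" for z
    using C that by (simp add: exp_add)
  moreover have "L holomorphic_on D"
    using L D(1) by (auto simp: holomorphic_on_open)
  ultimately show thesis
    by (intro that[of "Ln C"]) (auto simp: log_branch_def intro: holomorphic_intros)
qed

lemma has_field_derivative_log_branch:
  assumes "log_branch D q L" "open D" "z \<in> D" "(q has_field_derivative q') (at z)"
  shows "(L has_field_derivative q' / q z) (at z)"
proof -
  have e: "exp (L z) = q z" if "z \<in> D" for z using assms(1) that by (simp add: log_branch_def)
  have L: "(L has_field_derivative deriv L z) (at z)"
    using assms by (auto simp: log_branch_def intro: holomorphic_derivI)
  have "((\<lambda>z. exp (L z)) has_field_derivative exp (L z) * deriv L z) (at z)"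
    by (rule DERIV_fun_exp[OF L])
  then have "(q has_field_derivative exp (L z) * deriv L z) (at z)"
    by (rule has_field_derivative_transform_within_open[OF _ assms(2,3)]) (simp add: e)
  then have "q' = q z * deriv L z" using DERIV_unique[OF assms(4)] e[OF assms(3)] by simp
  moreover have "q z \<noteq> 0" using e[OF assms(3)] by (metis exp_not_eq_zero)
  ultimately show ?thesis using L by simp
qed

text \<open>\<open>D\<close> itself may have holes, but by connectedness it lies in one of the two
  open half-planes. These are convex, so the zero-free \<open>r\<close> has a logarithm on the whole
  half-plane.\<close>

lemma log_branch_off_imaginary_axis:
  assumes "connected D" "\<And>z. z \<in> D \<Longrightarrow> Re z \<noteq> 0"
    and r: "r holomorphic_on {z. Re z \<noteq> 0}" "\<And>z. Re z \<noteq> 0 \<Longrightarrow> r z \<noteq> 0"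
  obtains L where "log_branch D r L"
proof -
  note result = that
  have *: thesis if S: "D \<subseteq> S" "convex S" "S \<subseteq> {z. Re z \<noteq> 0}" for S
  proof -
    obtain g where "g holomorphic_on S" "\<And>z. z \<in> S \<Longrightarrow> r z = exp (g z)"
      using contractible_imp_holomorphic_log[of r S] holomorphic_on_subset[OF r(1) S(3)]
        convex_imp_contractible[OF S(2)] r(2) S(3) by blast
    then have "log_branch D r g"
      using S(1) holomorphic_on_subset by (auto simp: log_branch_def)
    then show thesis by (rule result)
  qed
  have "{z. Re z > 0} \<inter> D = {} \<or> {z. Re z < 0} \<inter> D = {}"
    using assms(2) by (intro connectedD[OF assms(1) open_halfspace_Re_gt open_halfspace_Re_lt]) (auto simp: neq_iff)
  then have "D \<subseteq> {z. Re z > 0} \<or> D \<subseteq> {z. Re z < 0}"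
    using assms(2) by (auto simp: neq_iff)
  then show thesis
    using *[OF _ convex_halfspace_Re_gt] *[OF _ convex_halfspace_Re_lt] by fastforce
qed

text \<open>If \<open>h = C q\<^sup>\<i>\<^sup>g\<close> with \<open>g\<close> real, then \<open>|h|\<close> determines the argument of \<open>q\<close>, so a
  single-valued \<open>h\<close> forces a single-valued logarithm of \<open>q\<close>.\<close>

lemma log_branch_of_imaginary_power:
  assumes D: "open D" "connected D" "D \<noteq> {}" and g: "g \<noteq> 0"
    and q: "\<And>z. z \<in> D \<Longrightarrow> (q has_field_derivative q' z) (at z)" "\<And>z. z \<in> D \<Longrightarrow> q z \<noteq> 0"
    and h: "\<And>z. z \<in> D \<Longrightarrow> (h has_field_derivative \<i> * of_real g * (q' z / q z) * h z) (at z)"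
      "\<And>z. z \<in> D \<Longrightarrow> h z \<noteq> 0"
  obtains L where "log_branch D q L"
proof -
  \<comment> \<open>For h = C q^(\<i> g) one has ln |h| = ln |C| - g arg q, so the second term
    supplies \<i> arg q up to a constant.\<close>
  define L where "L z = complex_of_real (ln (cmod (q z))) - \<i> * of_real (1 / g * ln (cmod (h z)))" for z
  have "(L has_field_derivative q' z / q z) (at z)" if z: "z \<in> D" for z
  proof -
    have "(L has_derivative (\<lambda>v. of_real (Re (q' z * v / q z))
        - \<i> * of_real (1 / g * Re (\<i> * of_real g * (q' z / q z) * h z * v / h z)))) (at z)"
      unfolding L_def
      by (intro has_derivative_diff has_derivative_mult_right has_derivative_of_real has_derivative_ln_cmod
          q(1)[OF z, unfolded has_field_derivative_def] h(1)[OF z, unfolded has_field_derivative_def] q(2) h(2) z)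
    \<comment> \<open>The factor \<i> in the equation for \<open>h\<close> turns the second real
      part into an imaginary part of \<open>q' z / q z * v\<close>. Thus the real differential of
      \<open>L\<close> is complex-linear, and \<open>L\<close> is holomorphic although built from
      moduli.\<close>
    moreover have "of_real (Re (q' z * v / q z))
        - \<i> * of_real (1 / g * Re (\<i> * of_real g * (q' z / q z) * h z * v / h z)) = q' z / q z * v" for v
    proof -
      have Re: "Re (of_real g * (\<i> * c)) = - g * Im c" for c by simp
      have "\<i> * of_real g * (q' z / q z) * h z * v / h z = of_real g * (\<i> * (q' z / q z * v))"
        using h(2)[OF z] by simp
      then have "1 / g * Re (\<i> * of_real g * (q' z / q z) * h z * v / h z) = - Im (q' z / q z * v)"
        using g by (simp only: Re) simp
      then show ?thesis by (simp add: complex_eq_iff)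
    qed
    ultimately show ?thesis unfolding has_field_derivative_def by (rule has_derivative_eq_rhs[OF _ ext])
  qed
  then show thesis
    using log_branch_of_logarithmic_derivative[OF D q] that by blast
qed

text \<open>Comparison of lowest-order terms at a zero of order \<open>n\<close>: put h = (z - p)^n
  g with g(p) \<noteq> 0 and divide the equation by (z - p)^(n-1). The value of the result at
  \<open>p\<close> gives \<open>a p = 0\<close>, its derivative gives the relation with \<beta>.
  Nonconstancy of \<open>h\<close> makes the order finite.\<close>

lemma zero_of_linear_ode_solution:
  assumes D: "open D" "connected D" and a: "a holomorphic_on D" and h: "h holomorphic_on D"
    and ode: "\<And>z. z \<in> D \<Longrightarrow> a z * deriv h z = \<beta> * h z"
    and nc: "\<not> h constant_on D" and p: "p \<in> D" "h p = 0"
  obtains n :: nat where "n > 0" "a p = 0" "of_nat n * deriv a p = \<beta>"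
proof -
  obtain g r n where n: "0 < n" and r: "0 < r" "ball p r \<subseteq> D" and g: "g holomorphic_on ball p r"
      and hg: "\<And>w. w \<in> ball p r \<Longrightarrow> h w = (w - p) ^ n * g w"
      and g0: "\<And>w. w \<in> ball p r \<Longrightarrow> g w \<noteq> 0"
    by (rule holomorphic_factor_zero_nonconstant[OF h D p nc]) blast
  let ?E = "\<lambda>z. a z * (of_nat n * g z + (z - p) * deriv g z) - \<beta> * (z - p) * g z"
  have a': "a holomorphic_on ball p r" using a r(2) by (rule holomorphic_on_subset)
  have g': "deriv g holomorphic_on ball p r" by (rule holomorphic_deriv[OF g]) simp
  have E0: "?E z = 0" if z: "z \<in> ball p r - {p}" for z
  proof -
    obtain m where m: "n = Suc m" using n gr0_conv_Suc by blast
    have zb: "z \<in> ball p r" and zp: "z - p \<noteq> 0" using z by auto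
    have dg: "(g has_field_derivative deriv g z) (at z)"
      using holomorphic_derivI[OF g _ zb] by simp
    have "((\<lambda>w. (w - p) ^ n * g w) has_field_derivative
       of_nat n * (z - p) ^ m * g z + (z - p) ^ n * deriv g z) (at z)"
      by (rule derivative_eq_intros dg refl)+ (simp add: m mult.commute del: power_Suc of_nat_Suc)
    then have "(h has_field_derivative of_nat n * (z - p) ^ m * g z + (z - p) ^ n * deriv g z) (at z)"
      by (rule has_field_derivative_transform_within_open[OF _ _ zb]) (simp_all add: hg)
    then have dh: "deriv h z = of_nat n * (z - p) ^ m * g z + (z - p) ^ n * deriv g z"
      by (rule DERIV_imp_deriv)
    \<comment> \<open>\<open>?E\<close> is the difference of the two sides after division by (z -
      p)^(n-1), with \<open>m\<close> = n - 1; cancelling this factor requires \<open>z\<close>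
      \<noteq> \<open>p\<close>.\<close>
    have "(z - p) ^ m * ?E z = a z * deriv h z - \<beta> * h z"
      unfolding dh hg[OF zb] m by (simp add: algebra_simps)
    also have "\<dots> = 0" using ode[of z] zb r(2) by auto
    finally show ?thesis using zp by simp
  qed
  have E: "?E z = 0" if "z \<in> ball p r" for z
  proof (rule analytic_continuation_open[of "ball p r - {p}" "ball p r" ?E "\<lambda>_. 0"])
    have "p + of_real (r / 2) \<in> ball p r - {p}" using r(1) by (simp add: dist_norm)
    then show "ball p r - {p} \<noteq> {}" by blast
    show "?E holomorphic_on ball p r" by (intro holomorphic_intros a' g g')
  qed (use that E0 in \<open>auto intro: open_delete\<close>)
  have pb: "p \<in> ball p r" using r(1) by simp
  have ap: "a p = 0" using E[OF pb] n g0[OF pb] by simp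
  have der: "(f has_field_derivative deriv f p) (at p)" if "f holomorphic_on ball p r" for f
    by (rule holomorphic_derivI[OF that _ pb]) simp
  \<comment> \<open>At \<open>p\<close> every term containing a derivative of \<open>g\<close>
    carries a factor \<open>z - p\<close> or \<open>a p\<close>, both of which are zero
    there.\<close>
  have "(?E has_field_derivative deriv a p * (of_nat n * g p) - \<beta> * g p) (at p)"
    by (rule derivative_eq_intros der[OF a'] der[OF g] der[OF g'] refl)+ (simp add: ap)
  moreover have "(?E has_field_derivative 0) (at p)"
    by (rule has_field_derivative_transform_within_open[OF DERIV_const[of 0] open_ball pb]) (simp add: E)
  ultimately have "deriv a p * (of_nat n * g p) - \<beta> * g p = 0" by (rule DERIV_unique)
  then have "g p * (of_nat n * deriv a p - \<beta>) = 0" by (simp add: algebra_simps)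
  then show thesis using that n ap g0[OF pb] by simp
qed

section \<open>The listed vector fields as symmetry generators\<close>

lemma deriv_quadratic:
  "deriv (\<lambda>z. C1 * (z + lam)\<^sup>2 + C2) z = 2 * C1 * (z + lam)" for z :: complex
  by (rule DERIV_imp_deriv) (auto intro!: derivative_eq_intros)

lemma deriv_linear: "deriv (\<lambda>z. c * z + C2) z = c" for z :: complex
  by (rule DERIV_imp_deriv) (auto intro!: derivative_eq_intros)

text \<open>Conjugation changes the sign of all three constants, so the listed coefficient at the
  conjugate variable is the conjugate of \<open>a\<close>.\<close>

lemma X_quadratic_eq_generator:
  assumes "imaginary lam" "imaginary C1" "imaginary C2"
  shows "X_quadratic \<alpha> \<beta> lam C1 C2 = generator \<alpha> \<beta> (\<lambda>z. C1 * (z + lam)\<^sup>2 + C2)"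
  using assms unfolding X_quadratic_def generator_def deriv_quadratic imaginary_def
  by (simp add: fun_eq_iff algebra_simps)

lemma X_linear_eq_generator:
  assumes "imaginary C2"
  shows "X_linear \<alpha> \<beta> C1 C2 = generator \<alpha> \<beta> (\<lambda>z. of_real C1 * z + C2)"
  using assms unfolding X_linear_def generator_def deriv_linear imaginary_def
  by (simp add: fun_eq_iff)

lemma X_shift_eq_generator: "X_shift = scale_vfield (- \<i>) (generator 0 0 (\<lambda>z. \<i>))"
  unfolding X_shift_def generator_def scale_vfield_def by (simp add: fun_eq_iff)

lemma scale_vfield_1: "scale_vfield 1 X = X"
  unfolding scale_vfield_def by (cases X) simp

lemma invariant_under_scale:
  assumes "c \<noteq> 0"
  shows "invariant_under \<Omega> u (scale_vfield c X) \<longleftrightarrow> invariant_under \<Omega> u X"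
proof -
  have "c * x * d + c * y * e + c * z * f = c * v \<longleftrightarrow> x * d + y * e + z * f = v" for x y z v d e f
    unfolding mult.assoc distrib_left[symmetric] using assms by simp
  then show ?thesis
    unfolding invariant_under_def scale_vfield_def vfield.sel by (simp only:)
qed

text \<open>Converse to \<open>quadratic_of_real_part_identity\<close>, in the form obtained by
  completing the square.\<close>

lemma quadratic_real_part_identity:
  assumes "imaginary lam" "imaginary C1" "imaginary C2"
  shows "Re (C1 * (z + lam)\<^sup>2 + C2) = Re z * Re (2 * C1 * (z + lam))"
  using assms by (simp add: imaginary_iff_Re power2_eq_square algebra_simps)

subsection \<open>The solution of the heavenly equation\<close>

locale liouville_solution =
  fixes D :: "complex set" and b :: "complex \<Rightarrow> complex"
  assumes open_D: "open D" and connected_D: "connected D" and nonempty_D: "D \<noteq> {}"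
    and Re_nonzero: "\<And>z. z \<in> D \<Longrightarrow> Re z \<noteq> 0"
    and holo_b: "b holomorphic_on D"
begin

abbreviation "\<Omega> \<equiv> u_dom D b"
abbreviation "w p \<equiv> of_real (snd p) + b (fst p)"

lemma mem_dom: "p \<in> \<Omega> \<longleftrightarrow> fst p \<in> D \<and> w p \<noteq> 0"
  by (cases p) (auto simp: u_dom_def)

lemma has_derivative_holomorphic_fst:
  assumes "f holomorphic_on D" "fst p \<in> D"
  shows "((\<lambda>q::complex \<times> real. f (fst q)) has_derivative (\<lambda>v. deriv f (fst p) * fst v)) (at p within S)"
proof -
  have "(f has_derivative (\<lambda>v. deriv f (fst p) * v)) (at (fst p))"
    using holomorphic_derivI[OF assms(1) open_D assms(2)] by (simp add: has_field_derivative_def)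
  from has_derivative_compose[OF has_derivative_fst[OF has_derivative_ident] this]
  show ?thesis .
qed

lemmas has_derivative_b = has_derivative_holomorphic_fst[OF holo_b]

lemma holo_deriv_b: "deriv b holomorphic_on D"
  by (rule holomorphic_deriv[OF holo_b open_D])

lemmas has_derivative_deriv_b = has_derivative_holomorphic_fst[OF holo_deriv_b]

lemma open_dom: "open \<Omega>"
proof -
  have "open (D \<times> (UNIV :: real set))"
    using open_D by (simp add: open_Times)
  moreover have "continuous_on (D \<times> UNIV) w"
  proof -
    have "continuous_on (D \<times> UNIV) (\<lambda>p::complex \<times> real. b (fst p))"
      by (rule continuous_on_compose2[OF holomorphic_on_imp_continuous_on[OF holo_b]])
         (auto intro: continuous_on_fst)
    then show ?thesis by (intro continuous_intros)
  qed
  ultimately have "open ((D \<times> UNIV) \<inter> w -` (- {0}))"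
    by (intro continuous_open_preimage) auto
  moreover have "(D \<times> UNIV) \<inter> w -` (- {0}) = \<Omega>"
    by (auto simp: mem_dom)
  ultimately show ?thesis by simp
qed

text \<open>Over each \<open>z\<close> at most one \<open>t\<close> is excluded, so nothing of
  \<open>D\<close> is lost in the projection by which admissibility of generators is
  defined.\<close>

lemma fst_dom: "fst ` \<Omega> = D"
proof
  show "fst ` \<Omega> \<subseteq> D" by (auto simp: mem_dom)
  show "D \<subseteq> fst ` \<Omega>"
  proof
    fix z assume z: "z \<in> D"
    \<comment> \<open>This choice gives \<open>w (z, t)\<close> real part 1.\<close>
    define t where "t = 1 - Re (b z)"
    have "w (z, t) \<noteq> 0" by (auto simp: t_def complex_eq_iff)
    then have "(z, t) \<in> \<Omega>" using z by (simp add: mem_dom)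
    then show "z \<in> fst ` \<Omega>" by force
  qed
qed

text \<open>Principal logarithms jump across the negative axis, their real parts do not. Keeping
  both terms as logarithms of moduli lets \<open>has_derivative_ln_cmod\<close> handle either sign
  of \<open>Re z\<close>.\<close>

lemma u_sol_real_form:
  assumes "p \<in> \<Omega>"
  shows "u_sol b p = 2 * ln (cmod (w p)) - 2 * ln (cmod (of_real (2 * Re (fst p))))"
proof -
  obtain z t where p: "p = (z, t)" by (cases p)
  have z: "z \<in> D" and nz: "of_real t + b z \<noteq> 0" using assms by (auto simp: p mem_dom)
  have nz': "of_real t + cnj (b z) \<noteq> 0"
    using nz by (metis complex_cnj_add complex_cnj_complex_of_real complex_cnj_zero_iff)
  have cm: "cmod (of_real t + cnj (b z)) = cmod (of_real t + b z)"
    by (metis complex_cnj_add complex_cnj_complex_of_real complex_mod_cnj)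
  have x: "z + cnj z = of_real (2 * Re z)" by (simp add: complex_add_cnj)
  have x0: "Re z \<noteq> 0" using Re_nonzero z by blast
  have "Re (Ln (z + cnj z)) = ln (cmod (of_real (2 * Re z)))"
    unfolding x using x0 by (subst Re_Ln) (auto simp del: of_real_mult)
  then show ?thesis
    using nz nz' cm by (simp add: p u_sol_def)
qed

lemma has_derivative_u_sol:
  assumes "p \<in> \<Omega>"
  shows "(u_sol b has_derivative
    (\<lambda>v. 2 * Re ((of_real (snd v) + deriv b (fst p) * fst v) / w p) - 2 * Re (fst v) / Re (fst p))) (at p)"
proof -
  have z: "fst p \<in> D" using assms by (simp add: mem_dom)
  have x0: "Re (fst p) \<noteq> 0" using Re_nonzero z by blast
  have 1: "(w has_derivative (\<lambda>v. of_real (snd v) + deriv b (fst p) * fst v)) (at p)"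
    by (rule derivative_eq_intros has_derivative_b z refl)+
  have 2: "((\<lambda>q::complex \<times> real. complex_of_real (2 * Re (fst q))) has_derivative
      (\<lambda>v. of_real (2 * Re (fst v)))) (at p)"
    by (intro has_derivative_of_real has_derivative_mult_right has_derivative_Re has_derivative_fst has_derivative_ident)
  have "((\<lambda>q. 2 * ln (cmod (w q)) - 2 * ln (cmod (of_real (2 * Re (fst q))))) has_derivative
     (\<lambda>v. 2 * Re ((of_real (snd v) + deriv b (fst p) * fst v) / w p)
        - 2 * Re (complex_of_real (2 * Re (fst v)) / of_real (2 * Re (fst p))))) (at p)"
    using assms x0
    by (intro has_derivative_diff has_derivative_mult_right has_derivative_ln_cmod 1 2) (auto simp: mem_dom)
  then have "((\<lambda>q. 2 * ln (cmod (w q)) - 2 * ln (cmod (of_real (2 * Re (fst q))))) has_derivative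
     (\<lambda>v. 2 * Re ((of_real (snd v) + deriv b (fst p) * fst v) / w p) - 2 * Re (fst v) / Re (fst p))) (at p)"
    using x0 by (simp flip: of_real_divide)
  then show ?thesis
    by (rule has_derivative_transform_within_open[OF _ open_dom assms]) (simp add: u_sol_real_form)
qed

lemma C2_u_sol: "C_k_on 2 \<Omega> (u_sol b)"
proof -
  \<comment> \<open>\<open>D1 v\<close> is the derivative of the solution in direction
    \<open>v\<close>, and \<open>D2 v v'\<close> below is the derivative of \<open>D1 v\<close> in
    direction \<open>v'\<close>.\<close>
  define D1 where "D1 v p = 2 * Re ((of_real (snd v) + deriv b (fst p) * fst v) / w p)
     - 2 * Re (fst v) / Re (fst p)" for v p
  define D2 where "D2 v v' p = 2 * Re ((deriv (deriv b) (fst p) * fst v' * fst v) / w p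
       - (of_real (snd v) + deriv b (fst p) * fst v) * (of_real (snd v') + deriv b (fst p) * fst v') / (w p)\<^sup>2)
     + 2 * Re (fst v) * Re (fst v') / (Re (fst p))\<^sup>2" for v v' p
  have u': "(u_sol b has_derivative (\<lambda>v. D1 v p)) (at p)" if "p \<in> \<Omega>" for p
    unfolding D1_def by (rule has_derivative_u_sol[OF that])
  have fu: "frechet_derivative (u_sol b) (at p) v = D1 v p" if "p \<in> \<Omega>" for p v
    by (rule fun_cong[OF frechet_derivative_at[OF u'[OF that], symmetric]])
  have D1': "(D1 v has_derivative (\<lambda>v'. D2 v v' p)) (at p)" if p: "p \<in> \<Omega>" for p v
  proof -
    have z: "fst p \<in> D" and nz: "w p \<noteq> 0" using p by (auto simp: mem_dom)
    have x0: "Re (fst p) \<noteq> 0" using Re_nonzero z by blast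
    have 1: "((\<lambda>p. (of_real (snd v) + deriv b (fst p) * fst v) / w p) has_derivative
      (\<lambda>v'. (deriv (deriv b) (fst p) * fst v' * fst v) / w p
       - (of_real (snd v) + deriv b (fst p) * fst v) * (of_real (snd v') + deriv b (fst p) * fst v') / (w p)\<^sup>2)) (at p)"
      by (rule derivative_eq_intros has_derivative_b has_derivative_deriv_b z nz refl)+
         (use nz in \<open>simp add: fun_eq_iff divide_simps power2_eq_square, simp add: algebra_simps\<close>)
    have 2: "((\<lambda>p. 2 * Re (fst v) / Re (fst p)) has_derivative
       (\<lambda>v'. - 2 * Re (fst v) * Re (fst v') / (Re (fst p))\<^sup>2)) (at p)"
      by (rule derivative_eq_intros x0 refl)+
         (use x0 in \<open>simp add: fun_eq_iff divide_simps power2_eq_square\<close>)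
    show ?thesis
      unfolding D1_def D2_def
      by (rule has_derivative_eq_rhs[OF has_derivative_diff[OF has_derivative_mult_right[OF has_derivative_Re[OF 1], of 2] 2]])
         simp
  qed
  have D1'': "((\<lambda>p. frechet_derivative (u_sol b) (at p) v) has_derivative (\<lambda>v'. D2 v v' p)) (at p)"
    if p: "p \<in> \<Omega>" for p v
    by (rule has_derivative_transform_within_open[OF D1'[OF p] open_dom p]) (simp add: fu)
  have fD: "frechet_derivative (\<lambda>p. frechet_derivative (u_sol b) (at p) v) (at p) v' = D2 v v' p"
    if "p \<in> \<Omega>" for p v v'
    by (rule fun_cong[OF frechet_derivative_at[OF D1''[OF that], symmetric]])
  have "continuous_on \<Omega> (D2 v v')" for v v'
  proof -
    have *: "continuous_on \<Omega> (\<lambda>p. f (fst p))" if "f holomorphic_on D" for f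
      by (rule continuous_on_compose2[OF holomorphic_on_imp_continuous_on[OF that]])
         (auto intro: continuous_on_fst simp: mem_dom)
    have "deriv (deriv b) holomorphic_on D"
      using holo_deriv_b open_D by (rule holomorphic_deriv)
    note * = *[OF this] *[OF holo_deriv_b] *[OF holo_b]
    show ?thesis unfolding D2_def
      using Re_nonzero by (intro continuous_intros *) (auto simp: mem_dom)
  qed
  then have "continuous_on \<Omega> (\<lambda>p. frechet_derivative (\<lambda>p. frechet_derivative (u_sol b) (at p) v) (at p) v')" for v v'
    by (rule continuous_on_eq) (simp add: fD)
  then show ?thesis
    using u' D1'' unfolding numeral_2_eq_2 C_k_on.simps differentiable_def by blast
qed

lemma has_derivative_complex_u_sol:
  assumes "p \<in> \<Omega>"
  shows "((\<lambda>q. complex_of_real (u_sol b q)) has_derivative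
    (\<lambda>v. of_real (2 * Re ((of_real (snd v) + deriv b (fst p) * fst v) / w p) - 2 * Re (fst v) / Re (fst p)))) (at p)"
  by (rule has_derivative_of_real[OF has_derivative_u_sol[OF assms]])

lemma frechet_u_sol:
  assumes "p \<in> \<Omega>"
  shows "frechet_derivative (\<lambda>q. complex_of_real (u_sol b q)) (at p) v =
    of_real (2 * Re ((of_real (snd v) + deriv b (fst p) * fst v) / w p) - 2 * Re (fst v) / Re (fst p))"
  by (rule fun_cong[OF frechet_derivative_at[OF has_derivative_complex_u_sol[OF assms], symmetric]])

section \<open>Wirtinger and time derivatives, and the two sides of the equation\<close>

lemma d_t_u_sol:
  assumes "p \<in> \<Omega>"
  shows "d_t (\<lambda>q. complex_of_real (u_sol b q)) p = of_real (2 * Re (1 / w p))"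
  unfolding d_t_def frechet_u_sol[OF assms] by simp

text \<open>For fixed \<open>t\<close> the differential is v -> 2 Re (c v) with c = b'/w - 1/Re z.
  The Wirtinger coefficients of such a differential are c and, for the next lemma, its
  conjugate.\<close>

lemma d_z_u_sol:
  assumes "p \<in> \<Omega>"
  shows "d_z (\<lambda>q. complex_of_real (u_sol b q)) p = deriv b (fst p) / w p - of_real (1 / Re (fst p))"
proof -
  have "Re (deriv b (fst p) * \<i> / w p) = - Im (deriv b (fst p) / w p)"
    by (metis Re_i_times mult.commute times_divide_eq_right)
  then show ?thesis
    unfolding d_z_def frechet_u_sol[OF assms]
    by (simp add: complex_eq_iff del: of_real_divide)
qed

lemma d_zbar_u_sol:
  assumes "p \<in> \<Omega>"
  shows "d_zbar (\<lambda>q. complex_of_real (u_sol b q)) p = cnj (deriv b (fst p) / w p) - of_real (1 / Re (fst p))"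
proof -
  have "Re (deriv b (fst p) * \<i> / w p) = - Im (deriv b (fst p) / w p)"
    by (metis Re_i_times mult.commute times_divide_eq_right)
  then show ?thesis
    unfolding d_zbar_def frechet_u_sol[OF assms]
    by (simp add: complex_eq_iff del: of_real_divide complex_cnj_divide)
qed

text \<open>The conjugate of b'/w is antiholomorphic in z and is annihilated; only -1/Re z
  contributes.\<close>

lemma d_z_d_zbar_u_sol:
  assumes "p \<in> \<Omega>"
  shows "d_z (d_zbar (\<lambda>q. complex_of_real (u_sol b q))) p = of_real (1 / (2 * (Re (fst p))\<^sup>2))"
proof -
  have z: "fst p \<in> D" and nz: "w p \<noteq> 0" using assms by (auto simp: mem_dom)
  have x0: "Re (fst p) \<noteq> 0" using Re_nonzero z by blast
  define K where "K = deriv (deriv b) (fst p) / w p - (deriv b (fst p))\<^sup>2 / (w p)\<^sup>2"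
  define K' where "K' = deriv b (fst p) / (w p)\<^sup>2"
  have 1: "((\<lambda>p. deriv b (fst p) / w p) has_derivative
      (\<lambda>v. K * fst v - K' * of_real (snd v))) (at p)"
    unfolding K_def K'_def
    by (rule derivative_eq_intros has_derivative_b has_derivative_deriv_b z nz refl)+
       (use nz in \<open>simp add: fun_eq_iff divide_simps power2_eq_square, simp add: algebra_simps\<close>)
  have 2: "((\<lambda>p. 1 / Re (fst p)) has_derivative (\<lambda>v. - Re (fst v) / (Re (fst p))\<^sup>2)) (at p)"
    by (rule derivative_eq_intros x0 refl)+
       (use x0 in \<open>simp add: fun_eq_iff divide_simps power2_eq_square\<close>)
  have "((\<lambda>p. cnj (deriv b (fst p) / w p) - of_real (1 / Re (fst p))) has_derivative
     (\<lambda>v. cnj (K * fst v - K' * of_real (snd v)) - of_real (- Re (fst v) / (Re (fst p))\<^sup>2))) (at p)"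
    by (intro has_derivative_diff has_derivative_cnj has_derivative_of_real 1 2)
  then have "((d_zbar (\<lambda>q. complex_of_real (u_sol b q))) has_derivative
     (\<lambda>v. cnj (K * fst v - K' * of_real (snd v)) - of_real (- Re (fst v) / (Re (fst p))\<^sup>2))) (at p)"
    by (rule has_derivative_transform_within_open[OF _ open_dom assms]) (simp only: d_zbar_u_sol)
  from frechet_derivative_at[OF this, symmetric] show ?thesis
    by (simp add: d_z_def algebra_simps)
qed

lemma exp_u_sol:
  assumes "p \<in> \<Omega>"
  shows "exp (u_sol b p) = (cmod (w p))\<^sup>2 / (2 * Re (fst p))\<^sup>2"
proof -
  have "Re (fst p) \<noteq> 0" "w p \<noteq> 0" using Re_nonzero assms by (auto simp: mem_dom)
  then show ?thesis
    unfolding u_sol_real_form[OF assms] exp_diff exp_double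
    by (simp only: norm_of_real exp_ln zero_less_norm_iff of_real_eq_0_iff mult_eq_0_iff
         zero_less_abs_iff power2_abs) simp
qed

text \<open>By \<open>exp_u_sol\<close> the exponential is ((t + Re b)^2 + (Im b)^2) / (2 Re z)^2, a
  quadratic polynomial in t.\<close>

lemma d_t_d_t_exp_u_sol:
  assumes "p \<in> \<Omega>"
  shows "d_t (d_t (\<lambda>q. complex_of_real (exp (u_sol b q)))) p = of_real (1 / (2 * (Re (fst p))\<^sup>2))"
proof -
  have 1: "d_t (\<lambda>q. complex_of_real (exp (u_sol b q))) p
      = of_real (exp (u_sol b p) * (2 * Re (1 / w p)))" if "p \<in> \<Omega>" for p
  proof -
    have "((\<lambda>q. complex_of_real (exp (u_sol b q))) has_derivative
      (\<lambda>v. of_real ((2 * Re ((of_real (snd v) + deriv b (fst p) * fst v) / w p) - 2 * Re (fst v) / Re (fst p))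
        * exp (u_sol b p)))) (at p)"
      by (intro has_derivative_of_real has_derivative_exp has_derivative_u_sol that)
    from frechet_derivative_at[OF this, symmetric] show ?thesis
      by (simp add: d_t_def)
  qed
  have 2: "d_t (\<lambda>q. complex_of_real (exp (u_sol b q))) p
      = of_real (Re (w p) / (2 * (Re (fst p))\<^sup>2))" if "p \<in> \<Omega>" for p
  proof -
    have "exp (u_sol b p) * (2 * Re (1 / w p)) = Re (w p) / (2 * (Re (fst p))\<^sup>2)"
      using that unfolding exp_u_sol[OF that] Re_divide cmod_power2[symmetric]
      by (simp add: mem_dom power_mult_distrib) (simp add: add_divide_distrib)
    then show ?thesis using 1[OF that] by simp
  qed
  have z: "fst p \<in> D" using assms by (simp add: mem_dom)
  have x0: "Re (fst p) \<noteq> 0" using Re_nonzero z by blast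
  \<comment> \<open>\<open>d_t\<close> evaluates a total derivative, so the dependence on z has to
    be differentiated as well, although only the direction (0, 1) is read off.\<close>
  have 3: "((\<lambda>p. 2 * (Re (fst p))\<^sup>2) has_derivative (\<lambda>v. 4 * Re (fst p) * Re (fst v))) (at p)"
    by (rule derivative_eq_intros refl)+ (simp add: fun_eq_iff)
  have 4: "((\<lambda>p. Re (w p)) has_derivative (\<lambda>v. Re (of_real (snd v) + deriv b (fst p) * fst v))) (at p)"
    by (rule derivative_eq_intros has_derivative_b z refl)+
  have "((\<lambda>p. Re (w p) / (2 * (Re (fst p))\<^sup>2)) has_derivative
     (\<lambda>v. (Re (of_real (snd v) + deriv b (fst p) * fst v) * (2 * (Re (fst p))\<^sup>2)
        - Re (w p) * (4 * Re (fst p) * Re (fst v))) / ((2 * (Re (fst p))\<^sup>2) * (2 * (Re (fst p))\<^sup>2)))) (at p)"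
    using x0 by (intro has_derivative_divide' 3 4) auto
  from has_derivative_of_real[OF this]
  have "(d_t (\<lambda>q. complex_of_real (exp (u_sol b q))) has_derivative
     (\<lambda>v. of_real ((Re (of_real (snd v) + deriv b (fst p) * fst v) * (2 * (Re (fst p))\<^sup>2)
        - Re (w p) * (4 * Re (fst p) * Re (fst v))) / ((2 * (Re (fst p))\<^sup>2) * (2 * (Re (fst p))\<^sup>2))))) (at p)"
    by (rule has_derivative_transform_within_open[OF _ open_dom assms]) (simp only: 2)
  from frechet_derivative_at[OF this, symmetric] show ?thesis
    using x0 by (simp add: d_t_def[of "d_t _"] divide_simps power2_eq_square power4_eq_xxxx)
qed

lemma heavenly_u_sol: "heavenly_solution 1 \<Omega> (u_sol b)"
  unfolding heavenly_solution_def
  using open_dom C2_u_sol d_z_d_zbar_u_sol d_t_d_t_exp_u_sol by simp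

subsection \<open>The invariance condition\<close>

lemma Re_quotient_constant:
  assumes "\<And>t::real. of_real t + c \<noteq> 0 \<Longrightarrow> Re (F / (of_real t + c)) = K"
  shows "K = 0" "Re F = 0" "Im F * Im c = 0"
proof -
  \<comment> \<open>Here \<open>s\<close> is \<open>t + Re c\<close>, the real part of the
    denominator; \<open>s\<close> \<noteq> 0 keeps the denominator nonzero. The three values 1, -1
    and 2 suffice: the first two isolate \<open>Re F\<close>, then 1 and 2 isolate
    \<open>K\<close>.\<close>
  have *: "Re F * s + Im F * Im c = K * (s\<^sup>2 + (Im c)\<^sup>2)" if "s \<noteq> 0" for s :: real
  proof -
    let ?d = "of_real (s - Re c) + c"
    have d: "Re ?d = s" "Im ?d = Im c" by simp_all
    then have "?d \<noteq> 0" using that by (metis zero_complex.sel(1))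
    then have "(Re F * s + Im F * Im c) / (s\<^sup>2 + (Im c)\<^sup>2) = K"
      using assms[of "s - Re c"] d by (simp add: Re_divide)
    moreover have "s\<^sup>2 + (Im c)\<^sup>2 \<noteq> 0" using that by (simp add: sum_power2_eq_zero_iff)
    ultimately show ?thesis by (simp add: field_simps)
  qed
  from *[of 1] *[of "-1"] show "Re F = 0" by simp
  moreover from *[of 1] *[of 2] calculation show "K = 0" by (simp add: algebra_simps)
  ultimately show "Im F * Im c = 0" using *[of 1] by simp
qed

lemma invariant_under_generator_iff:
  assumes a: "a holomorphic_on D"
  shows "invariant_under \<Omega> (u_sol b) (generator \<alpha> \<beta> a) \<longleftrightarrow>
   (\<forall>z\<in>D. Re (a z) = Re z * Re (deriv a z) \<and> a z * deriv b z = of_real \<beta> * b z - of_real \<alpha>)"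
proof -
  let ?F = "\<lambda>z. of_real \<alpha> - of_real \<beta> * b z + a z * deriv b z"
  have inv: "invariant_under \<Omega> (u_sol b) (generator \<alpha> \<beta> a) \<longleftrightarrow>
     (\<forall>z\<in>D. \<forall>t::real. of_real t + b z \<noteq> 0 \<longrightarrow>
        Re (?F z / (of_real t + b z)) = Re (a z) / Re z - Re (deriv a z))"
  proof -
    have "coef_t (generator \<alpha> \<beta> a) p * d_t (\<lambda>q. complex_of_real (u_sol b q)) p
           + coef_z (generator \<alpha> \<beta> a) p * d_z (\<lambda>q. complex_of_real (u_sol b q)) p
           + coef_zbar (generator \<alpha> \<beta> a) p * d_zbar (\<lambda>q. complex_of_real (u_sol b q)) p
           = coef_u (generator \<alpha> \<beta> a) p
        \<longleftrightarrow> Re (?F (fst p) / w p) = Re (a (fst p)) / Re (fst p) - Re (deriv a (fst p))"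
      if p: "p \<in> \<Omega>" for p
    proof -
      obtain z t where pzt: "p = (z, t)" by (cases p)
      have nz: "of_real t + b z \<noteq> 0" and z: "z \<in> D" using p by (auto simp: pzt mem_dom)
      define W where "W = of_real t + b z"
      have W: "W \<noteq> 0" using nz by (simp add: W_def)
      have cnj_sum: "c + cnj c = of_real (2 * Re c)" for c by (simp add: complex_add_cnj)
      have "of_real (\<alpha> + \<beta> * t) * of_real (2 * Re (1 / W))
           + a z * (deriv b z / W - of_real (1 / Re z))
           + cnj (a z) * (cnj (deriv b z / W) - of_real (1 / Re z))
         = complex_of_real ((\<alpha> + \<beta> * t) * (2 * Re (1 / W)))
           + (a z * deriv b z / W + cnj (a z * deriv b z / W)) - of_real (1 / Re z) * (a z + cnj (a z))"
        by (simp add: algebra_simps)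
      also have "\<dots> = of_real (2 * ((\<alpha> + \<beta> * t) * Re (1 / W) + Re (a z * deriv b z / W) - Re (a z) / Re z))"
        unfolding cnj_sum by simp
      also have "(\<alpha> + \<beta> * t) * Re (1 / W) + Re (a z * deriv b z / W) = \<beta> + Re (?F z / W)"
      \<comment> \<open>Writing \<alpha> + \<beta> t = \<beta> W + (\<alpha> - \<beta> b) splits off
        the constant \<beta>, which cancels the 2 \<beta> in the coefficient at the
        u-derivative.\<close>
      proof -
        have "of_real (\<alpha> + \<beta> * t) * (1 / W) + a z * deriv b z / W = of_real \<beta> + ?F z / W"
          using W by (simp add: field_simps) (simp add: W_def algebra_simps)
        from arg_cong[OF this, of Re] show ?thesis
          unfolding plus_complex.sel Re_complex_of_real scaleR_conv_of_real[symmetric] scaleR_complex.sel .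
      qed
      finally have L: "of_real (\<alpha> + \<beta> * t) * of_real (2 * Re (1 / W))
           + a z * (deriv b z / W - of_real (1 / Re z))
           + cnj (a z) * (cnj (deriv b z / W) - of_real (1 / Re z))
         = complex_of_real (2 * (\<beta> + Re (?F z / W) - Re (a z) / Re z))" .
      have R: "2 * of_real \<beta> - (deriv a z + cnj (deriv a z)) = complex_of_real (2 * (\<beta> - Re (deriv a z)))"
        unfolding cnj_sum by simp
      show ?thesis
        unfolding d_t_u_sol[OF p] d_z_u_sol[OF p] d_zbar_u_sol[OF p]
        unfolding pzt generator_def vfield.sel prod.case fst_conv snd_conv W_def[symmetric] L R of_real_eq_iff
        by auto
    qed
    then have "invariant_under \<Omega> (u_sol b) (generator \<alpha> \<beta> a) \<longleftrightarrow>
      (\<forall>p\<in>\<Omega>. Re (?F (fst p) / w p) = Re (a (fst p)) / Re (fst p) - Re (deriv a (fst p)))"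
      unfolding invariant_under_def by (intro ball_cong refl)
    moreover have "(\<forall>p\<in>\<Omega>. P p) \<longleftrightarrow> (\<forall>z\<in>D. \<forall>t. of_real t + b z \<noteq> 0 \<longrightarrow> P (z, t))" for P
      by (auto simp: u_dom_def)
    ultimately show ?thesis by (simp only: fst_conv snd_conv)
  qed
  show ?thesis
  proof
    assume "invariant_under \<Omega> (u_sol b) (generator \<alpha> \<beta> a)"
    then have *: "\<And>t. of_real t + b z \<noteq> 0 \<Longrightarrow>
        Re (?F z / (of_real t + b z)) = Re (a z) / Re z - Re (deriv a z)" if "z \<in> D" for z
      using inv that by blast
    have **: "Re (a z) / Re z - Re (deriv a z) = 0" "Re (?F z) = 0" "Im (?F z) * Im (b z) = 0" if "z \<in> D" for z
      using Re_quotient_constant[of "b z" "?F z" "Re (a z) / Re z - Re (deriv a z)"] *[OF that] by blast+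
    show "\<forall>z\<in>D. Re (a z) = Re z * Re (deriv a z) \<and> a z * deriv b z = of_real \<beta> * b z - of_real \<alpha>"
    proof (intro ballI conjI)
      fix z assume z: "z \<in> D"
      show "Re (a z) = Re z * Re (deriv a z)"
        using **(1)[OF z] Re_nonzero[OF z] by (simp add: field_simps)
      have F: "?F holomorphic_on D" by (intro holomorphic_intros a holo_b holo_deriv_b)
      have "(?F has_field_derivative 0) (at x)" if x: "x \<in> D" for x
      proof -
        have "deriv ?F x = 0" by (rule Re_zero_imp_deriv_zero[OF open_D F _ x]) (rule **(2))
        then show ?thesis using holomorphic_derivI[OF F open_D x, where T = UNIV] by (simp only:)
      qed
      then obtain C where C: "\<forall>x\<in>D. ?F x = C"
        using deriv_zero_constant[OF open_D connected_D, of ?F] by blast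
      have "?F z = 0"
      proof (rule ccontr)
        assume nz: "?F z \<noteq> 0"
        have "Im (?F x) \<noteq> 0" if "x \<in> D" for x
        proof
          assume "Im (?F x) = 0"
          then have "?F x = 0" using **(2)[OF that] by (simp only: complex_eq_iff zero_complex.sel)
          then show False using C that z nz by metis
        qed
        then have Imb: "Im (b x) = 0" if "x \<in> D" for x
          using **(3)[OF that] that by (metis mult_eq_0_iff)
        \<comment> \<open>\<open>b\<close> is real-valued, so multiplication by \<i> makes the real
          part vanish. Once \<open>b\<close> has derivative zero, \<open>?F z\<close> is \<alpha> -
          \<beta> \<open>b z\<close>, which is real.\<close>
        have "deriv (\<lambda>x. \<i> * b x) z = 0"
          by (rule Re_zero_imp_deriv_zero[OF open_D _ _ z]) (simp_all add: Imb holo_b holomorphic_on_mult)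
        then have "deriv b z = 0"
          using holo_b open_D z by (simp add: deriv_cmult holomorphic_on_imp_differentiable_at)
        then have "Im (?F z) = 0" using Imb[OF z] by simp
        then show False using \<open>\<And>x. x \<in> D \<Longrightarrow> Im (?F x) \<noteq> 0\<close> z by blast
      qed
      then show "a z * deriv b z = of_real \<beta> * b z - of_real \<alpha>" by (simp add: algebra_simps)
    qed
  next
    assume *: "\<forall>z\<in>D. Re (a z) = Re z * Re (deriv a z) \<and> a z * deriv b z = of_real \<beta> * b z - of_real \<alpha>"
    show "invariant_under \<Omega> (u_sol b) (generator \<alpha> \<beta> a)"
      unfolding inv
    proof (intro ballI allI impI)
      fix z t assume z: "z \<in> D"
      then have "?F z = 0" using * by simp
      then show "Re (?F z / (of_real t + b z)) = Re (a z) / Re z - Re (deriv a z)"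
        using * z Re_nonzero[OF z] by (simp only: ) simp
    qed
  qed
qed

subsection \<open>Invariance of the listed solutions\<close>

lemma invariant_under_symmetry_generatorI:
  assumes a: "a holomorphic_on D"
    and nz: "\<alpha> \<noteq> 0 \<or> \<beta> \<noteq> 0 \<or> (\<exists>z\<in>D. a z \<noteq> 0)" and c: "c \<noteq> 0"
    and "\<And>z. z \<in> D \<Longrightarrow> Re (a z) = Re z * Re (deriv a z)"
    and "\<And>z. z \<in> D \<Longrightarrow> a z * deriv b z = of_real \<beta> * b z - of_real \<alpha>"
  shows "invariant_under_symmetry \<Omega> (u_sol b) (scale_vfield c (generator \<alpha> \<beta> a))"
proof -
  have "symmetry_generator D (scale_vfield c (generator \<alpha> \<beta> a))"
    unfolding symmetry_generator_def admissible_generator_def using a nz c by blast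
  then show ?thesis
    unfolding invariant_under_symmetry_def fst_dom invariant_under_scale[OF c]
      invariant_under_generator_iff[OF a] using assms by blast
qed

text \<open>A nonzero complex factor does not affect the invariance equation, so the real
  representative of the field can serve as the generator.\<close>

lemma invariant_solution_if_invariant_under_symmetry:
  assumes "invariant_under_symmetry \<Omega> (u_sol b) X"
  shows "invariant_solution 1 \<Omega> (u_sol b)"
  using assms heavenly_u_sol invariant_under_scale
  unfolding invariant_under_symmetry_def symmetry_generator_def invariant_solution_def by metis

lemma deriv_b_eq:
  assumes "\<forall>z\<in>D. b z = f z" "z \<in> D" "(f has_field_derivative d) (at z)"
  shows "deriv b z = d"
  by (rule DERIV_imp_deriv, rule has_field_derivative_transform_within_open[OF assms(3) open_D assms(2)])
     (simp add: assms(1))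

lemma add_imaginary_nonzero: "imaginary c \<Longrightarrow> z \<in> D \<Longrightarrow> z + c \<noteq> 0"
  using Re_nonzero[of z] by (auto simp: imaginary_iff_Re complex_eq_iff)

lemma linear_nonzero: "imaginary c \<Longrightarrow> r \<noteq> 0 \<Longrightarrow> z \<in> D \<Longrightarrow> of_real r * z + c \<noteq> 0"
  using Re_nonzero[of z] by (auto simp: imaginary_iff_Re complex_eq_iff)

section \<open>Invariance criteria for quadratic and linear fields\<close>

text \<open>The nonvanishing of \<open>a\<close> makes the generator nontrivial even when \<alpha> =
  \<beta> = 0.\<close>

lemma invariant_under_X_quadratic:
  assumes "imaginary lam" "imaginary C1" "imaginary C2"
    and "\<And>z. z \<in> D \<Longrightarrow> C1 * (z + lam)\<^sup>2 + C2 \<noteq> 0"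
    and "\<And>z. z \<in> D \<Longrightarrow> (C1 * (z + lam)\<^sup>2 + C2) * deriv b z = of_real \<beta> * b z - of_real \<alpha>"
  shows "invariant_under_symmetry \<Omega> (u_sol b) (X_quadratic \<alpha> \<beta> lam C1 C2)"
  unfolding X_quadratic_eq_generator[OF assms(1-3)]
  using invariant_under_symmetry_generatorI[of "\<lambda>z. C1 * (z + lam)\<^sup>2 + C2" \<alpha> \<beta> 1]
    quadratic_real_part_identity[OF assms(1-3)] assms(4,5) nonempty_D
  unfolding deriv_quadratic scale_vfield_1 by (fastforce intro: holomorphic_intros)

lemma invariant_under_X_linear:
  assumes "imaginary C2" "\<beta> \<noteq> 0 \<or> C1 \<noteq> 0 \<or> C2 \<noteq> 0"
    and "\<And>z. z \<in> D \<Longrightarrow> (of_real C1 * z + C2) * deriv b z = of_real \<beta> * b z - of_real \<alpha>"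
  shows "invariant_under_symmetry \<Omega> (u_sol b) (X_linear \<alpha> \<beta> C1 C2)"
proof -
  obtain z where "z \<in> D" using nonempty_D by blast
  then have "\<alpha> \<noteq> 0 \<or> \<beta> \<noteq> 0 \<or> (\<exists>z\<in>D. of_real C1 * z + C2 \<noteq> 0)"
    using assms(2) linear_nonzero[OF assms(1)] by (cases "C1 = 0") auto
  then show ?thesis
    unfolding X_linear_eq_generator[OF assms(1)]
    using invariant_under_symmetry_generatorI[of "\<lambda>z. of_real C1 * z + C2" \<alpha> \<beta> 1] assms(1,3)
    unfolding deriv_linear scale_vfield_1 by (fastforce simp: imaginary_iff_Re intro: holomorphic_intros)
qed

lemma quadratic_factorization:
  fixes C1 C2 lam \<nu> z :: complex
  assumes "C1 \<noteq> 0" "\<nu>\<^sup>2 = - C2 / C1"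
  shows "C1 * (z + lam)\<^sup>2 + C2 = C1 * ((z + lam - \<nu>) * (z + lam + \<nu>))"
proof -
  have "C2 = - C1 * \<nu>\<^sup>2" unfolding assms(2) using assms(1) by simp
  then show ?thesis by (simp add: power2_eq_square algebra_simps)
qed

text \<open>The exponential has no zeros and \<open>x / 0 = 0\<close>, so a branch for the quotient
  already encodes that numerator and denominator are nonzero.\<close>

lemma log_branch_quotient_nonzero:
  assumes "log_branch D (\<lambda>z. (z + p) / (z + q)) L" "z \<in> D"
  shows "z + p \<noteq> 0" "z + q \<noteq> 0"
  using assms unfolding log_branch_def by (metis divide_eq_0_iff exp_not_eq_zero)+

lemma has_field_derivative_log_quotient:
  assumes L: "log_branch D (\<lambda>z. (z + p) / (z + q)) L" and z: "z \<in> D"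
  shows "(L has_field_derivative (q - p) / ((z + p) * (z + q))) (at z)"
proof -
  note nz = log_branch_quotient_nonzero[OF L z]
  have "((\<lambda>z. (z + p) / (z + q)) has_field_derivative (q - p) / (z + q)\<^sup>2) (at z)"
    using nz by (auto intro!: derivative_eq_intros simp: power2_eq_square)
  from has_field_derivative_log_branch[OF L open_D z this]
  have "(L has_field_derivative (q - p) / (z + q)\<^sup>2 / ((z + p) / (z + q))) (at z)" .
  moreover have "(q - p) / (z + q)\<^sup>2 / ((z + p) / (z + q)) = (q - p) / ((z + p) * (z + q))"
    using nz by (simp add: power2_eq_square)
  ultimately show ?thesis by (simp only:)
qed

text \<open>With the linear factors p, q of the quadratic, a = C1 p q and L' = 2 \<nu> / (p q).
  Hence a times the derivative of the exponent is exactly \<beta>.\<close>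

lemma b_power_quadratic_invariant:
  assumes "b_power_quadratic D b \<alpha> \<beta> lam C1 C2 \<nu> C"
  shows "invariant_under_symmetry \<Omega> (u_sol b) (X_quadratic \<alpha> \<beta> lam C1 C2)"
proof -
  from assms obtain L where im: "imaginary lam" "imaginary C1" "imaginary C2"
    and nz: "C1 \<noteq> 0" "C2 \<noteq> 0" "\<beta> \<noteq> 0" and \<nu>: "\<nu>\<^sup>2 = - C2 / C1"
    and L: "log_branch D (\<lambda>z. (z + (lam - \<nu>)) / (z + (lam + \<nu>))) L"
    and b: "\<forall>z\<in>D. b z = C * exp (of_real \<beta> / (2 * (C1 * \<nu>)) * L z) + of_real (\<alpha> / \<beta>)"
    unfolding b_power_quadratic_def by (auto simp: algebra_simps)
  have \<nu>0: "\<nu> \<noteq> 0" using \<nu> nz by auto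
  show ?thesis
  proof (rule invariant_under_X_quadratic[OF im])
    fix z assume z: "z \<in> D"
    define p q where "p = z + (lam - \<nu>)" and "q = z + (lam + \<nu>)"
    have p: "p \<noteq> 0" and q: "q \<noteq> 0"
      using log_branch_quotient_nonzero[OF L z] by (simp_all add: p_def q_def)
    have a: "C1 * (z + lam)\<^sup>2 + C2 = C1 * (p * q)"
      using quadratic_factorization[OF nz(1) \<nu>] by (simp add: p_def q_def algebra_simps)
    then show "C1 * (z + lam)\<^sup>2 + C2 \<noteq> 0" using p q nz by simp
    have L': "(L has_field_derivative 2 * \<nu> / (p * q)) (at z)"
      using has_field_derivative_log_quotient[OF L z] by (simp add: p_def q_def)
    have "deriv b z = C * (exp (of_real \<beta> / (2 * (C1 * \<nu>)) * L z) * (of_real \<beta> / (2 * (C1 * \<nu>)) * (2 * \<nu> / (p * q))))"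
      by (rule deriv_b_eq[OF b z]) (rule derivative_eq_intros L' refl | simp add: ac_simps)+
    moreover have "of_real \<beta> / (2 * (C1 * \<nu>)) * (2 * \<nu> / (p * q)) = of_real \<beta> / (C1 * (p * q))"
      using \<nu>0 by simp
    ultimately show "(C1 * (z + lam)\<^sup>2 + C2) * deriv b z = of_real \<beta> * b z - of_real \<alpha>"
      unfolding a using p q nz \<nu>0 b z by (simp add: distrib_left)
  qed
qed

text \<open>The quotient is inverted compared with the power case, which reverses the sign of L' and
  produces the required - \<alpha>.\<close>

lemma b_log_quadratic_invariant:
  assumes "b_log_quadratic D b \<alpha> lam C1 C2 \<nu> C"
  shows "invariant_under_symmetry \<Omega> (u_sol b) (X_quadratic \<alpha> 0 lam C1 C2)"
proof -
  from assms obtain L where im: "imaginary lam" "imaginary C1" "imaginary C2"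
    and nz: "C1 \<noteq> 0" "C2 \<noteq> 0" and \<nu>: "\<nu>\<^sup>2 = - C2 / C1"
    and L: "log_branch D (\<lambda>z. (z + (lam + \<nu>)) / (z + (lam - \<nu>))) L"
    and b: "\<forall>z\<in>D. b z = of_real \<alpha> / (2 * (C1 * \<nu>)) * L z + C"
    unfolding b_log_quadratic_def by (auto simp: algebra_simps)
  have \<nu>0: "\<nu> \<noteq> 0" using \<nu> nz by auto
  show ?thesis
  proof (rule invariant_under_X_quadratic[OF im])
    fix z assume z: "z \<in> D"
    define p q where "p = z + (lam - \<nu>)" and "q = z + (lam + \<nu>)"
    have p: "p \<noteq> 0" and q: "q \<noteq> 0"
      using log_branch_quotient_nonzero[OF L z] by (simp_all add: p_def q_def)
    have a: "C1 * (z + lam)\<^sup>2 + C2 = C1 * (p * q)"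
      using quadratic_factorization[OF nz(1) \<nu>] by (simp add: p_def q_def algebra_simps)
    then show "C1 * (z + lam)\<^sup>2 + C2 \<noteq> 0" using p q nz by simp
    have L': "(L has_field_derivative - (2 * \<nu>) / (q * p)) (at z)"
      using has_field_derivative_log_quotient[OF L z] by (simp add: p_def q_def)
    have "deriv b z = of_real \<alpha> / (2 * (C1 * \<nu>)) * (- (2 * \<nu>) / (q * p))"
      by (rule deriv_b_eq[OF b z]) (rule derivative_eq_intros L' refl | simp add: ac_simps)+
    then show "(C1 * (z + lam)\<^sup>2 + C2) * deriv b z = of_real 0 * b z - of_real \<alpha>"
      unfolding a using p q nz \<nu>0 by simp
  qed
qed

lemma b_exp_pole_invariant:
  assumes "b_exp_pole D b \<alpha> \<beta> lam C1 C"
  shows "invariant_under_symmetry \<Omega> (u_sol b) (X_quadratic \<alpha> \<beta> lam C1 0)"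
proof -
  from assms have im: "imaginary lam" "imaginary C1" and nz: "C1 \<noteq> 0" "\<beta> \<noteq> 0"
    and b: "\<forall>z\<in>D. b z = C * exp (- (of_real \<beta> / (C1 * (z + lam)))) + of_real (\<alpha> / \<beta>)"
    unfolding b_exp_pole_def by auto
  show ?thesis
  proof (rule invariant_under_X_quadratic)
    fix z assume z: "z \<in> D"
    note z0 = add_imaginary_nonzero[OF im(1) z]
    show "C1 * (z + lam)\<^sup>2 + 0 \<noteq> 0" using z0 nz by simp
    have "deriv b z = C * (exp (- (of_real \<beta> / (C1 * (z + lam)))) * (of_real \<beta> / (C1 * (z + lam)\<^sup>2)))"
      by (rule deriv_b_eq[OF b z])
         (use z0 nz in \<open>auto intro!: derivative_eq_intros simp: power2_eq_square ac_simps\<close>)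
    then show "(C1 * (z + lam)\<^sup>2 + 0) * deriv b z = of_real \<beta> * b z - of_real \<alpha>"
      using z0 nz b z by (simp add: distrib_left)
  qed (use im in \<open>auto simp: imaginary_def\<close>)
qed

lemma b_pole_invariant:
  assumes "b_pole D b \<alpha> lam C1 C"
  shows "invariant_under_symmetry \<Omega> (u_sol b) (X_quadratic \<alpha> 0 lam C1 0)"
proof -
  from assms have im: "imaginary lam" "imaginary C1" and nz: "C1 \<noteq> 0"
    and b: "\<forall>z\<in>D. b z = of_real \<alpha> / (C1 * (z + lam)) + C"
    unfolding b_pole_def by auto
  show ?thesis
  proof (rule invariant_under_X_quadratic)
    fix z assume z: "z \<in> D"
    note z0 = add_imaginary_nonzero[OF im(1) z]
    show "C1 * (z + lam)\<^sup>2 + 0 \<noteq> 0" using z0 nz by simp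
    have "deriv b z = - of_real \<alpha> / (C1 * (z + lam)\<^sup>2)"
      by (rule deriv_b_eq[OF b z])
         (use z0 nz in \<open>auto intro!: derivative_eq_intros simp: power2_eq_square ac_simps\<close>)
    then show "(C1 * (z + lam)\<^sup>2 + 0) * deriv b z = of_real 0 * b z - of_real \<alpha>"
      using z0 nz by simp
  qed (use im in \<open>auto simp: imaginary_def\<close>)
qed

lemma has_field_derivative_log_linear:
  assumes L: "log_branch D (\<lambda>z. c * z + C2) L" and z: "z \<in> D"
  shows "(L has_field_derivative c / (c * z + C2)) (at z)"
  by (rule has_field_derivative_log_branch[OF L open_D z]) (auto intro!: derivative_eq_intros)

lemma b_power_linear_invariant:
  assumes "b_power_linear D b \<alpha> \<beta> C1 C2 C"
  shows "invariant_under_symmetry \<Omega> (u_sol b) (X_linear \<alpha> \<beta> C1 C2)"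
proof -
  from assms obtain L where im: "imaginary C2" and nz: "C1 \<noteq> 0" "\<beta> \<noteq> 0"
    and L: "log_branch D (\<lambda>z. of_real C1 * z + C2) L"
    and b: "\<forall>z\<in>D. b z = C * exp (of_real (\<beta> / C1) * L z) + of_real (\<alpha> / \<beta>)"
    unfolding b_power_linear_def by auto
  show ?thesis
  proof (rule invariant_under_X_linear)
    fix z assume z: "z \<in> D"
    note z0 = linear_nonzero[OF im nz(1) z]
    have "deriv b z = C * (exp (of_real (\<beta> / C1) * L z) * (of_real (\<beta> / C1) * (of_real C1 / (of_real C1 * z + C2))))"
      by (rule deriv_b_eq[OF b z])
         (rule derivative_eq_intros has_field_derivative_log_linear[OF L z] refl | simp add: ac_simps)+
    then show "(of_real C1 * z + C2) * deriv b z = of_real \<beta> * b z - of_real \<alpha>"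
      using z0 nz b z by (simp add: distrib_left)
  qed (use im nz in auto)
qed

lemma b_log_linear_invariant:
  assumes "b_log_linear D b \<alpha> C1 C2 C"
  shows "invariant_under_symmetry \<Omega> (u_sol b) (X_linear \<alpha> 0 C1 C2)"
proof -
  from assms obtain L where im: "imaginary C2" and nz: "C1 \<noteq> 0"
    and L: "log_branch D (\<lambda>z. of_real C1 * z + C2) L"
    and b: "\<forall>z\<in>D. b z = - of_real (\<alpha> / C1) * L z + C"
    unfolding b_log_linear_def by auto
  show ?thesis
  proof (rule invariant_under_X_linear)
    fix z assume z: "z \<in> D"
    note z0 = linear_nonzero[OF im nz z]
    have "deriv b z = - of_real (\<alpha> / C1) * (of_real C1 / (of_real C1 * z + C2))"
      by (rule deriv_b_eq[OF b z])
         (rule derivative_eq_intros has_field_derivative_log_linear[OF L z] refl | simp add: ac_simps)+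
    then show "(of_real C1 * z + C2) * deriv b z = of_real 0 * b z - of_real \<alpha>"
      using z0 nz by simp
  qed (use im nz in auto)
qed

lemma b_exp_invariant:
  assumes "b_exp D b \<alpha> \<beta> C2 C"
  shows "invariant_under_symmetry \<Omega> (u_sol b) (X_linear \<alpha> \<beta> 0 C2)"
proof -
  from assms have im: "imaginary C2" and nz: "C2 \<noteq> 0" "\<beta> \<noteq> 0"
    and b: "\<forall>z\<in>D. b z = C * exp (of_real \<beta> / C2 * z) + of_real (\<alpha> / \<beta>)"
    unfolding b_exp_def by auto
  show ?thesis
  proof (rule invariant_under_X_linear)
    fix z assume z: "z \<in> D"
    have "deriv b z = C * (exp (of_real \<beta> / C2 * z) * (of_real \<beta> / C2))"
      by (rule deriv_b_eq[OF b z]) (rule derivative_eq_intros refl | simp add: ac_simps)+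
    then show "(of_real 0 * z + C2) * deriv b z = of_real \<beta> * b z - of_real \<alpha>"
      using nz b z by (simp add: distrib_left)
  qed (use im nz in auto)
qed

lemma b_affine_invariant:
  assumes "b_affine D b \<alpha> C2 C"
  shows "invariant_under_symmetry \<Omega> (u_sol b) (X_linear \<alpha> 0 0 C2)"
proof -
  from assms have im: "imaginary C2" and nz: "C2 \<noteq> 0"
    and b: "\<forall>z\<in>D. b z = - (of_real \<alpha> / C2) * z + C"
    unfolding b_affine_def by auto
  show ?thesis
  proof (rule invariant_under_X_linear)
    fix z assume z: "z \<in> D"
    have "deriv b z = - (of_real \<alpha> / C2)"
      by (rule deriv_b_eq[OF b z]) (rule derivative_eq_intros refl | simp add: ac_simps)+
    then show "(of_real 0 * z + C2) * deriv b z = of_real 0 * b z - of_real \<alpha>"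
      using nz by simp
  qed (use im nz in auto)
qed

lemma b_const_deriv: "b_const D b c \<Longrightarrow> z \<in> D \<Longrightarrow> deriv b z = 0"
  by (rule deriv_b_eq[of "\<lambda>_. c"]) (simp_all add: b_const_def)

lemma b_const_invariant_shift:
  assumes "b_const D b c"
  shows "invariant_under_symmetry \<Omega> (u_sol b) X_shift"
  unfolding X_shift_eq_generator
  by (rule invariant_under_symmetry_generatorI) (use nonempty_D b_const_deriv[OF assms] in auto)

text \<open>Here a = 0, and the equation degenerates to \<beta> b = \<alpha>.\<close>

lemma b_const_invariant_scaling:
  assumes "b_const D b (of_real (\<alpha> / \<beta>))" "\<beta> \<noteq> 0"
  shows "invariant_under_symmetry \<Omega> (u_sol b) (X_linear \<alpha> \<beta> 0 0)"
  by (rule invariant_under_X_linear) (use assms in \<open>auto simp: imaginary_def b_const_def\<close>)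

subsection \<open>Integration of the invariance equation\<close>

abbreviation classified where
  "classified \<equiv>
     (\<exists>\<alpha> \<beta> lam C1 C2 \<nu> C. b_power_quadratic D b \<alpha> \<beta> lam C1 C2 \<nu> C) \<or>
     (\<exists>\<alpha> lam C1 C2 \<nu> C. b_log_quadratic D b \<alpha> lam C1 C2 \<nu> C) \<or>
     (\<exists>\<alpha> \<beta> lam C1 C. b_exp_pole D b \<alpha> \<beta> lam C1 C) \<or>
     (\<exists>\<alpha> lam C1 C. b_pole D b \<alpha> lam C1 C) \<or>
     (\<exists>\<alpha> \<beta> C1 C2 C. b_power_linear D b \<alpha> \<beta> C1 C2 C) \<or>
     (\<exists>\<alpha> C1 C2 C. b_log_linear D b \<alpha> C1 C2 C) \<or>
     (\<exists>\<alpha> \<beta> C2 C. b_exp D b \<alpha> \<beta> C2 C) \<or>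
     (\<exists>\<alpha> C2 C. b_affine D b \<alpha> C2 C) \<or>
     (\<exists>c. b_const D b c)"

lemma classifiedI:
  "b_power_quadratic D b \<alpha> \<beta> lam C1 C2 \<nu> C \<Longrightarrow> classified"
  "b_log_quadratic D b \<alpha> lam C1 C2 \<nu> C \<Longrightarrow> classified"
  "b_exp_pole D b \<alpha> \<beta> lam C1 C \<Longrightarrow> classified"
  "b_pole D b \<alpha> lam C1 C \<Longrightarrow> classified"
  "b_power_linear D b \<alpha> \<beta> R1 C2 C \<Longrightarrow> classified"
  "b_log_linear D b \<alpha> R1 C2 C \<Longrightarrow> classified"
  "b_exp D b \<alpha> \<beta> C2 C \<Longrightarrow> classified"
  "b_affine D b \<alpha> C2 C \<Longrightarrow> classified"
  "b_const D b C \<Longrightarrow> classified"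
  by ((((rule disjI1)?, (rule exI)+, assumption) | rule disjI2)+)

section \<open>General solution of the equation for \<open>b\<close>\<close>

lemma has_field_derivative_b: "z \<in> D \<Longrightarrow> (b has_field_derivative deriv b z) (at z)"
  by (rule holomorphic_derivI[OF holo_b open_D])

text \<open>\<open>deriv b\<close> vanishes on the nonempty open set where \<open>a\<close> \<noteq>
  0, and the identity theorem carries this to \<open>D\<close>. This disposes of \<alpha> = \<beta>
  = 0.\<close>

lemma constant_if_product_zero:
  assumes a: "a holomorphic_on D" and z: "z1 \<in> D" "a z1 \<noteq> 0"
    and ab: "\<And>z. z \<in> D \<Longrightarrow> a z * deriv b z = 0"
  obtains c where "b_const D b c"
proof -
  have "open (D \<inter> a -` (- {0}))"
    using holomorphic_on_imp_continuous_on[OF a] open_D by (rule continuous_open_preimage) (simp add: open_Compl)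
  moreover have "z1 \<in> D \<inter> a -` (- {0})" using z by simp
  ultimately have "deriv b z = 0" if "z \<in> D" for z
    using analytic_continuation_open[of "D \<inter> a -` (- {0})" D "deriv b" "\<lambda>_. 0" z]
      open_D connected_D holo_deriv_b that ab by fastforce
  then have "(b has_field_derivative 0) (at z)" if "z \<in> D" for z
    using has_field_derivative_b[OF that] that by simp
  then show thesis
    using deriv_zero_constant[OF open_D connected_D, of b] that unfolding b_const_def by blast
qed

lemma shifted_ode:
  assumes "\<beta> \<noteq> 0" and "\<And>z. z \<in> D \<Longrightarrow> a z * deriv b z = of_real \<beta> * b z - of_real \<alpha>"
    and "z \<in> D" "a z \<noteq> 0"
  shows "((\<lambda>z. b z - of_real (\<alpha> / \<beta>)) has_field_derivative
    of_real \<beta> / a z * (b z - of_real (\<alpha> / \<beta>))) (at z)"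
proof -
  have "of_real \<beta> / a z * (b z - of_real (\<alpha> / \<beta>)) = (of_real \<beta> * b z - of_real \<alpha>) / a z"
    using assms(1) by (simp add: right_diff_distrib diff_divide_distrib)
  then have "deriv b z = of_real \<beta> / a z * (b z - of_real (\<alpha> / \<beta>))"
    using assms(4) by (simp flip: assms(2)[OF assms(3)])
  with DERIV_diff[OF has_field_derivative_b[OF assms(3)] DERIV_const[of "of_real (\<alpha> / \<beta>)"]]
  show ?thesis by simp
qed

text \<open>Subtracting the particular solution \<alpha>/\<beta> makes the equation homogeneous.
  Each case with \<beta> \<noteq> 0 thereby reduces to exhibiting a single-valued primitive
  \<open>M\<close> of \<beta>/a; \<open>additive_form\<close> plays this part for \<beta> =
  0.\<close>

lemma exponential_form:
  assumes "\<beta> \<noteq> 0" and "\<And>z. z \<in> D \<Longrightarrow> a z * deriv b z = of_real \<beta> * b z - of_real \<alpha>"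
    and "\<And>z. z \<in> D \<Longrightarrow> a z \<noteq> 0"
    and "\<And>z. z \<in> D \<Longrightarrow> (M has_field_derivative of_real \<beta> / a z) (at z)"
  obtains C where "\<forall>z\<in>D. b z = C * exp (M z) + of_real (\<alpha> / \<beta>)"
proof -
  obtain C where "\<forall>z\<in>D. b z - of_real (\<alpha> / \<beta>) = C * exp (M z)"
    by (rule linear_ode_solution[OF open_D connected_D assms(4) shifted_ode[OF assms(1,2) _ assms(3)]])
  then show thesis using that[of C] by (simp add: diff_eq_eq)
qed

lemma additive_form:
  assumes "\<And>z. z \<in> D \<Longrightarrow> a z * deriv b z = - of_real \<alpha>"
    and "\<And>z. z \<in> D \<Longrightarrow> a z \<noteq> 0"
    and "\<And>z. z \<in> D \<Longrightarrow> (M has_field_derivative - of_real \<alpha> / a z) (at z)"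
  obtains C where "\<forall>z\<in>D. b z = M z + C"
proof -
  have b': "(b has_field_derivative - of_real \<alpha> / a z) (at z)" if "z \<in> D" for z
    using has_field_derivative_b[OF that] assms(1,2)[OF that] by (metis nonzero_mult_div_cancel_left)
  obtain C where "\<forall>z\<in>D. b z = M z + C"
    by (rule constant_difference[OF open_D connected_D b' assms(3)])
  then show thesis by (rule that)
qed

section \<open>Integration according to the shape of \<open>a\<close>\<close>

text \<open>At a double zero 1/a has no residue, so its primitive is rational and no logarithm is
  involved; the zero \<open>-lam\<close> lies on the imaginary axis, outside
  \<open>D\<close>.\<close>

lemma classified_quadratic_pole:
  assumes im: "imaginary lam" "imaginary C1" and C1: "C1 \<noteq> 0"
    and ode: "\<And>z. z \<in> D \<Longrightarrow> (C1 * (z + lam)\<^sup>2) * deriv b z = of_real \<beta> * b z - of_real \<alpha>"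
  shows classified
proof -
  have nz: "C1 * (z + lam)\<^sup>2 \<noteq> 0" if "z \<in> D" for z
    using add_imaginary_nonzero[OF im(1) that] C1 by simp
  have M: "((\<lambda>z. - (k / (C1 * (z + lam)))) has_field_derivative k / (C1 * (z + lam)\<^sup>2)) (at z)"
    if "z \<in> D" for z k
    using add_imaginary_nonzero[OF im(1) that] C1
    by (auto intro!: derivative_eq_intros simp: power2_eq_square ac_simps)
  show ?thesis
  proof (cases "\<beta> = 0")
    case False
    obtain C where "\<forall>z\<in>D. b z = C * exp (- (of_real \<beta> / (C1 * (z + lam)))) + of_real (\<alpha> / \<beta>)"
      by (rule exponential_form[OF False ode nz M])
    then have "b_exp_pole D b \<alpha> \<beta> lam C1 C"
      unfolding b_exp_pole_def using im C1 False by blast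
    then show ?thesis by (rule classifiedI)
  next
    case True
    then have "\<And>z. z \<in> D \<Longrightarrow> (C1 * (z + lam)\<^sup>2) * deriv b z = - of_real \<alpha>" using ode by simp
    then obtain C where "\<forall>z\<in>D. b z = - (- of_real \<alpha> / (C1 * (z + lam))) + C"
      by (rule additive_form[OF _ nz M])
    then have "b_pole D b \<alpha> lam C1 C"
      unfolding b_pole_def using im C1 by simp
    then show ?thesis by (rule classifiedI)
  qed
qed

text \<open>For imaginary \<open>\<nu>\<close> the zeros \<open>-lam \<plusminus> \<nu>\<close> of \<open>a\<close> lie on the imaginary axis. For real \<open>\<nu>\<close> the
  derivative of \<open>a\<close> at its zeros is imaginary, which excludes zeros in \<open>D\<close> because a zero of order \<open>n\<close>
  of \<open>b - \<alpha>/\<beta>\<close> forces \<open>n a' = \<beta>\<close>; moreover the exponent is imaginary.\<close>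

lemma log_branch_quadratic:
  assumes im: "imaginary lam" "imaginary C1" "imaginary C2" and C: "C1 \<noteq> 0" "C2 \<noteq> 0"
    and \<nu>: "\<nu>\<^sup>2 = - C2 / C1" and \<beta>: "\<beta> \<noteq> 0" and nc: "\<And>c. \<not> b_const D b c"
    and ode: "\<And>z. z \<in> D \<Longrightarrow> (C1 * (z + lam)\<^sup>2 + C2) * deriv b z = of_real \<beta> * b z - of_real \<alpha>"
  obtains L where "log_branch D (\<lambda>z. (z + lam - \<nu>) / (z + lam + \<nu>)) L"
proof -
  have \<nu>0: "\<nu> \<noteq> 0" using C \<nu> by auto
  have Re: "Re lam = 0" "Re C1 = 0" "Re C2 = 0" using im by (simp_all add: imaginary_iff_Re)
  \<comment> \<open>A quotient of imaginary numbers is real, and a complex number with real square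
    is real or imaginary.\<close>
  have "Im (\<nu>\<^sup>2) = 0" unfolding \<nu> using Re by (simp add: Im_divide)
  then have "Re \<nu> = 0 \<or> Im \<nu> = 0" by (auto simp: power2_eq_square)
  then show thesis
  proof
    assume Re\<nu>: "Re \<nu> = 0"
    have nz: "z + lam + \<nu> \<noteq> 0" "z + lam - \<nu> \<noteq> 0" if "Re z \<noteq> 0" for z
      using that Re Re\<nu> by (auto simp: complex_eq_iff)
    have hol: "(\<lambda>z. (z + lam - \<nu>) / (z + lam + \<nu>)) holomorphic_on {z. Re z \<noteq> 0}"
      using nz by (auto intro!: holomorphic_intros)
    show thesis
      by (rule log_branch_off_imaginary_axis[OF connected_D Re_nonzero hol]) (use nz that in auto)
  next
    assume Im\<nu>: "Im \<nu> = 0"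
    define a where "a = (\<lambda>z. C1 * (z + lam)\<^sup>2 + C2)"
    define h where "h = (\<lambda>z. b z - of_real (\<alpha> / \<beta>))"
    have a: "a holomorphic_on D" and h: "h holomorphic_on D"
      unfolding a_def h_def by (intro holomorphic_intros holo_b)+
    have dh: "deriv h z = deriv b z" if "z \<in> D" for z
      unfolding h_def
      using DERIV_diff[OF has_field_derivative_b[OF that] DERIV_const[of "of_real (\<alpha> / \<beta>)"]]
      by (simp add: DERIV_imp_deriv)
    have odeh: "a z * deriv h z = of_real \<beta> * h z" if "z \<in> D" for z
      using ode[OF that] dh[OF that] \<beta> by (simp add: a_def h_def algebra_simps)
    have hnc: "\<not> h constant_on D"
    proof
      assume "h constant_on D"
      then obtain c where "\<forall>z\<in>D. h z = c" by (auto simp: constant_on_def)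
      then have "b_const D b (c + of_real (\<alpha> / \<beta>))" by (auto simp: b_const_def h_def)
      then show False using nc by blast
    qed
    have fact: "a z = C1 * ((z + lam - \<nu>) * (z + lam + \<nu>))" for z
      unfolding a_def by (rule quadratic_factorization[OF C(1) \<nu>])
    have hnz: "h z \<noteq> 0" if z: "z \<in> D" for z
    proof
      assume hz: "h z = 0"
      obtain n :: nat where az: "a z = 0" and n: "of_nat n * deriv a z = of_real \<beta>"
        by (rule zero_of_linear_ode_solution[OF open_D connected_D a h odeh hnc z hz])
      have "z + lam = \<nu> \<or> z + lam = - \<nu>" using az fact C by (auto simp: eq_neg_iff_add_eq_0)
      then have "Im (z + lam) = 0"
        using Im\<nu> by (elim disjE; simp only: uminus_complex.sel neg_equal_0_iff_equal)
      then have "Re (deriv a z) = 0"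
        unfolding a_def deriv_quadratic using Re by simp
      then have "Re (of_nat n * deriv a z) = 0" by simp
      then show False using n \<beta> by simp
    qed
    have anz: "a z \<noteq> 0" if z: "z \<in> D" for z
      using odeh[OF z] hnz[OF z] \<beta> by auto
    then have nz: "z + lam - \<nu> \<noteq> 0" "z + lam + \<nu> \<noteq> 0" if "z \<in> D" for z
      using fact that by auto
    define g where "g = Im (of_real \<beta> / (2 * (C1 * \<nu>)))"
    have g: "of_real \<beta> / (2 * (C1 * \<nu>)) = \<i> * of_real g"
      unfolding g_def using Re Im\<nu> by (simp add: complex_eq_iff Re_divide)
    have g0: "g \<noteq> 0" using g \<beta> C \<nu>0 by auto
    have dq: "((\<lambda>z. (z + lam - \<nu>) / (z + lam + \<nu>)) has_field_derivative 2 * \<nu> / (z + lam + \<nu>)\<^sup>2) (at z)"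
      if "z \<in> D" for z
      using nz[OF that] by (auto intro!: derivative_eq_intros simp: power2_eq_square)
    have qnz: "(z + lam - \<nu>) / (z + lam + \<nu>) \<noteq> 0" if "z \<in> D" for z
      using nz[OF that] by simp
    have dh': "(h has_field_derivative \<i> * of_real g * (2 * \<nu> / (z + lam + \<nu>)\<^sup>2 / ((z + lam - \<nu>) / (z + lam + \<nu>))) * h z) (at z)"
      if z: "z \<in> D" for z
    proof -
      \<comment> \<open>The logarithmic derivative of the quotient is 2 \<nu> C1 / a, and the factor
        \<beta> / (2 C1 \<nu>) is imaginary because C1 is imaginary and \<nu> is real.\<close>
      have "of_real \<beta> / a z = \<i> * of_real g * (2 * \<nu> / (z + lam + \<nu>)\<^sup>2 / ((z + lam - \<nu>) / (z + lam + \<nu>)))"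
        unfolding g[symmetric] fact using nz[OF z] \<nu>0 C by (simp add: power2_eq_square)
      then show ?thesis
        using shifted_ode[OF \<beta> ode z] anz[OF z] unfolding h_def a_def by simp
    qed
    show thesis
      by (rule log_branch_of_imaginary_power[OF open_D connected_D nonempty_D g0 dq qnz dh' hnz that])
  qed
qed

text \<open>The branch comes from \<open>log_branch_quadratic\<close> if \<beta> \<noteq> 0. For
  \<beta> = 0 the given single-valued \<open>b\<close> already is such a branch after an affine
  change, which requires \<alpha> \<noteq> 0.\<close>

lemma classified_quadratic:
  assumes im: "imaginary lam" "imaginary C1" "imaginary C2" and C1: "C1 \<noteq> 0" and C2: "C2 \<noteq> 0"
    and ode: "\<And>z. z \<in> D \<Longrightarrow> (C1 * (z + lam)\<^sup>2 + C2) * deriv b z = of_real \<beta> * b z - of_real \<alpha>"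
    and nc: "\<And>c. \<not> b_const D b c" and \<alpha>: "\<beta> = 0 \<Longrightarrow> \<alpha> \<noteq> 0"
  shows classified
proof -
  define \<nu> where "\<nu> = csqrt (- C2 / C1)"
  have \<nu>: "\<nu>\<^sup>2 = - C2 / C1" unfolding \<nu>_def by simp
  have \<nu>0: "\<nu> \<noteq> 0" using C1 C2 \<nu> by auto
  note fact = quadratic_factorization[OF C1 \<nu>]
  show ?thesis
  proof (cases "\<beta> = 0")
    case False
    obtain L where L: "log_branch D (\<lambda>z. (z + lam - \<nu>) / (z + lam + \<nu>)) L"
      by (rule log_branch_quadratic[OF im C1 C2 \<nu> False nc ode])
    then have L': "log_branch D (\<lambda>z. (z + (lam - \<nu>)) / (z + (lam + \<nu>))) L" by (simp add: algebra_simps)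
    have nz: "z + lam - \<nu> \<noteq> 0" "z + lam + \<nu> \<noteq> 0" if "z \<in> D" for z
      using log_branch_quotient_nonzero[OF L' that] by (simp_all add: algebra_simps)
    have anz: "C1 * (z + lam)\<^sup>2 + C2 \<noteq> 0" if "z \<in> D" for z
      unfolding fact using C1 nz[OF that] by simp
    have M: "((\<lambda>z. of_real \<beta> / (2 * (C1 * \<nu>)) * L z) has_field_derivative of_real \<beta> / (C1 * (z + lam)\<^sup>2 + C2)) (at z)"
      if z: "z \<in> D" for z
    proof -
      have "(L has_field_derivative 2 * \<nu> / ((z + lam - \<nu>) * (z + lam + \<nu>))) (at z)"
        using has_field_derivative_log_quotient[OF L' z] by (simp add: algebra_simps)
      from DERIV_cmult[OF this, of "of_real \<beta> / (2 * (C1 * \<nu>))"]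
      show ?thesis unfolding fact using \<nu>0 by simp
    qed
    obtain C where "\<forall>z\<in>D. b z = C * exp (of_real \<beta> / (2 * (C1 * \<nu>)) * L z) + of_real (\<alpha> / \<beta>)"
      by (rule exponential_form[OF False ode anz M])
    then have "b_power_quadratic D b \<alpha> \<beta> lam C1 C2 \<nu> C"
      unfolding b_power_quadratic_def using im C1 C2 False \<nu> L by blast
    then show ?thesis by (rule classifiedI)
  next
    case True
    then have \<alpha>: "\<alpha> \<noteq> 0" and ode: "\<And>z. z \<in> D \<Longrightarrow> (C1 * (z + lam)\<^sup>2 + C2) * deriv b z = - of_real \<alpha>"
      using \<alpha> ode by auto
    \<comment> \<open>The right-hand side - \<alpha> never vanishes, so neither does
      \<open>a\<close>.\<close>
    have nz: "z + lam - \<nu> \<noteq> 0" "z + lam + \<nu> \<noteq> 0" if "z \<in> D" for z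
      using ode[OF that] \<alpha> unfolding fact by auto
    let ?k = "of_real \<alpha> / (2 * (C1 * \<nu>))"
    have k: "?k \<noteq> 0" using \<alpha> C1 \<nu>0 by simp
    have "((\<lambda>z. (z + lam + \<nu>) / (z + lam - \<nu>)) has_field_derivative - (2 * \<nu>) / (z + lam - \<nu>)\<^sup>2) (at z)"
      if "z \<in> D" for z
      using nz[OF that] by (auto intro!: derivative_eq_intros simp: power2_eq_square)
    moreover have "(z + lam + \<nu>) / (z + lam - \<nu>) \<noteq> 0" if "z \<in> D" for z
      using nz[OF that] by simp
    \<comment> \<open>The constant \<open>?k\<close> is the coefficient of the logarithm in
      \<open>b_log_quadratic\<close>; dividing by it gives \<open>b\<close> the logarithmic
      derivative of the quotient.\<close>
    moreover have "((\<lambda>z. b z / ?k) has_field_derivative - (2 * \<nu>) / (z + lam - \<nu>)\<^sup>2 / ((z + lam + \<nu>) / (z + lam - \<nu>))) (at z)"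
      if z: "z \<in> D" for z
    proof -
      define p q where "p = z + lam - \<nu>" and "q = z + lam + \<nu>"
      have pq: "p \<noteq> 0" "q \<noteq> 0" using nz[OF z] by (simp_all add: p_def q_def)
      have "C1 * (p * q) * deriv b z = - of_real \<alpha>"
        using ode[OF z] unfolding fact p_def q_def .
      then have "deriv b z = - of_real \<alpha> / (C1 * (p * q))"
        using pq C1 by (metis mult_eq_0_iff nonzero_mult_div_cancel_left)
      then have "deriv b z / ?k = - (2 * \<nu>) / p\<^sup>2 / (q / p)"
        using pq C1 \<alpha> \<nu>0 by (simp add: power2_eq_square)
      then show ?thesis
        using DERIV_cdivide[OF has_field_derivative_b[OF z], of ?k] unfolding p_def q_def by simp
    qed
    ultimately obtain K where "log_branch D (\<lambda>z. (z + lam + \<nu>) / (z + lam - \<nu>)) (\<lambda>z. b z / ?k + K)"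
      by (rule log_branch_of_logarithmic_derivative[OF open_D connected_D nonempty_D])
    moreover have "\<forall>z\<in>D. b z = ?k * (b z / ?k + K) + - (?k * K)"
      using k by (simp add: distrib_left)
    ultimately have "b_log_quadratic D b \<alpha> lam C1 C2 \<nu> (- (?k * K))"
      unfolding b_log_quadratic_def using im C1 C2 \<nu> by blast
    then show ?thesis by (rule classifiedI)
  qed
qed

text \<open>The only zero of a is -C2/C1, a point of the imaginary axis, so the half-plane
  containing \<open>D\<close> carries the branch.\<close>

lemma classified_linear:
  assumes im: "imaginary C2" and C1: "C1 \<noteq> 0"
    and ode: "\<And>z. z \<in> D \<Longrightarrow> (of_real C1 * z + C2) * deriv b z = of_real \<beta> * b z - of_real \<alpha>"
  shows classified
proof -
  have nz': "of_real C1 * z + C2 \<noteq> 0" if "Re z \<noteq> 0" for z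
    using that im C1 by (auto simp: imaginary_iff_Re complex_eq_iff)
  have "(\<lambda>z. of_real C1 * z + C2) holomorphic_on {z. Re z \<noteq> 0}" by (intro holomorphic_intros)
  then obtain L where L: "log_branch D (\<lambda>z. of_real C1 * z + C2) L"
    using log_branch_off_imaginary_axis[OF connected_D Re_nonzero] nz' by blast
  have nz: "of_real C1 * z + C2 \<noteq> 0" if "z \<in> D" for z
    using nz' Re_nonzero that by blast
  have M: "((\<lambda>z. of_real (k / C1) * L z) has_field_derivative of_real k / (of_real C1 * z + C2)) (at z)"
    if "z \<in> D" for z k
    using DERIV_cmult[OF has_field_derivative_log_linear[OF L that], of "of_real (k / C1)"] C1 by simp
  show ?thesis
  proof (cases "\<beta> = 0")
    case False
    obtain C where "\<forall>z\<in>D. b z = C * exp (of_real (\<beta> / C1) * L z) + of_real (\<alpha> / \<beta>)"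
      by (rule exponential_form[OF False ode nz M])
    then have "b_power_linear D b \<alpha> \<beta> C1 C2 C"
      unfolding b_power_linear_def using im C1 False L by blast
    then show ?thesis by (rule classifiedI)
  next
    case True
    then have "\<And>z. z \<in> D \<Longrightarrow> (of_real C1 * z + C2) * deriv b z = - of_real \<alpha>" using ode by simp
    then obtain C where "\<forall>z\<in>D. b z = of_real (- \<alpha> / C1) * L z + C"
      by (rule additive_form[OF _ nz M[of _ "- \<alpha>", unfolded of_real_minus]])
    then have "b_log_linear D b \<alpha> C1 C2 C"
      unfolding b_log_linear_def using im C1 L by auto
    then show ?thesis by (rule classifiedI)
  qed
qed

lemma classified_shift:
  assumes im: "imaginary C2" and C2: "C2 \<noteq> 0"
    and ode: "\<And>z. z \<in> D \<Longrightarrow> C2 * deriv b z = of_real \<beta> * b z - of_real \<alpha>"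
  shows classified
proof -
  have M: "((\<lambda>z. k / C2 * z) has_field_derivative k / C2) (at z)" for z k
    by (rule DERIV_cmult_Id)
  show ?thesis
  proof (cases "\<beta> = 0")
    case False
    obtain C where "\<forall>z\<in>D. b z = C * exp (of_real \<beta> / C2 * z) + of_real (\<alpha> / \<beta>)"
      by (rule exponential_form[OF False ode C2 M])
    then have "b_exp D b \<alpha> \<beta> C2 C"
      unfolding b_exp_def using im C2 False by blast
    then show ?thesis by (rule classifiedI)
  next
    case True
    then have "\<And>z. z \<in> D \<Longrightarrow> C2 * deriv b z = - of_real \<alpha>" using ode by simp
    then obtain C where "\<forall>z\<in>D. b z = - of_real \<alpha> / C2 * z + C"
      by (rule additive_form[OF _ C2 M])
    then have "b_affine D b \<alpha> C2 C"
      unfolding b_affine_def using im C2 by simp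
    then show ?thesis by (rule classifiedI)
  qed
qed

section \<open>Completeness of the list and the equivalence\<close>

lemma classified_if_invariant:
  assumes "invariant_solution 1 \<Omega> (u_sol b)"
  shows classified
\<comment> \<open>A constant \<open>b\<close> can be invariant under a quadratic field with a zero
  inside \<open>D\<close>, where no branch exists; it is therefore assigned to its own class at
  once.\<close>
proof (cases "\<exists>c. b_const D b c")
  case False
  then have nc: "\<And>c. \<not> b_const D b c" by blast
  obtain \<alpha> \<beta> a where adm: "admissible_generator D \<alpha> \<beta> a"
    and inv: "invariant_under \<Omega> (u_sol b) (generator \<alpha> \<beta> a)"
    using assms unfolding invariant_solution_def fst_dom by blast
  have a: "a holomorphic_on D" using adm by (simp add: admissible_generator_def)
  have re: "\<And>z. z \<in> D \<Longrightarrow> Re (a z) = Re z * Re (deriv a z)"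
    and ode: "\<And>z. z \<in> D \<Longrightarrow> a z * deriv b z = of_real \<beta> * b z - of_real \<alpha>"
    using inv unfolding invariant_under_generator_iff[OF a] by auto
  have \<alpha>: "\<alpha> \<noteq> 0" if \<beta>: "\<beta> = 0"
  proof
    assume "\<alpha> = 0"
    then obtain z where z: "z \<in> D" "a z \<noteq> 0" using adm \<beta> by (auto simp: admissible_generator_def)
    have "a z * deriv b z = 0" if "z \<in> D" for z using ode[OF that] \<open>\<alpha> = 0\<close> \<beta> by simp
    then show False using constant_if_product_zero[OF a z] nc by blast
  qed
  obtain A E G where im: "imaginary A" "imaginary G"
    and "\<forall>z\<in>D. a z = A * z\<^sup>2 + of_real E * z + G"
    by (rule quadratic_of_real_part_identity[OF open_D connected_D nonempty_D Re_nonzero a re])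
  then have aq: "a z = A * z\<^sup>2 + of_real E * z + G" if "z \<in> D" for z using that by blast
  show ?thesis
  proof (cases "A = 0")
    case False
    \<comment> \<open>Completing the square. As \<open>A\<close> is imaginary and \<open>E\<close>
      real, \<open>lam\<close> is imaginary; its square is then real, so \<open>C2\<close> is
      imaginary too.\<close>
    define lam C2 where "lam = of_real E / (2 * A)" and "C2 = G - A * lam\<^sup>2"
    have "a z = A * (z + lam)\<^sup>2 + C2" if "z \<in> D" for z
      unfolding aq[OF that] C2_def lam_def using False
      by (simp add: power2_eq_square field_simps)
    then have ode': "(A * (z + lam)\<^sup>2 + C2) * deriv b z = of_real \<beta> * b z - of_real \<alpha>" if "z \<in> D" for z
      using ode[OF that] that by simp
    have lam: "imaginary lam" using im by (simp add: lam_def imaginary_iff_Re Re_divide)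
    have C2: "imaginary C2"
      using im lam by (simp add: C2_def imaginary_iff_Re power2_eq_square)
    show ?thesis
    proof (cases "C2 = 0")
      case True
      show ?thesis
        by (rule classified_quadratic_pole[OF lam im(1) False, of \<beta> \<alpha>]) (use ode' True in simp)
    next
      case C2nz: False
      show ?thesis
        by (rule classified_quadratic[OF lam im(1) C2 False C2nz ode' nc \<alpha>])
    qed
  next
    case A: True
    show ?thesis
    proof (cases "E = 0")
      case False
      show ?thesis
        by (rule classified_linear[OF im(2) False, of \<beta> \<alpha>]) (use ode aq A in simp)
    next
      case E: True
      show ?thesis
      proof (cases "G = 0")
        case False
        show ?thesis
          by (rule classified_shift[OF im(2) False, of \<beta> \<alpha>]) (use ode aq A E in simp)
      next
        \<comment> \<open>Now a = 0 throughout \<open>D\<close>. The value \<beta> = 0 would give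
          \<alpha> = 0, which is excluded, so \<open>b\<close> equals \<alpha>/\<beta>.\<close>
        case True
        then have "of_real \<beta> * b z = of_real \<alpha>" if "z \<in> D" for z
          using ode[OF that] aq[OF that] A E by simp
        moreover from this have "\<beta> \<noteq> 0" using \<alpha> nonempty_D by fastforce
        ultimately have "b_const D b (of_real \<alpha> / of_real \<beta>)"
          by (simp add: b_const_def field_simps)
        then show ?thesis by (rule classifiedI)
      qed
    qed
  qed
qed (auto intro: classifiedI(9))

lemmas invariant_forms =
  b_power_quadratic_invariant[THEN invariant_solution_if_invariant_under_symmetry]
  b_log_quadratic_invariant[THEN invariant_solution_if_invariant_under_symmetry]
  b_exp_pole_invariant[THEN invariant_solution_if_invariant_under_symmetry]
  b_pole_invariant[THEN invariant_solution_if_invariant_under_symmetry]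
  b_power_linear_invariant[THEN invariant_solution_if_invariant_under_symmetry]
  b_log_linear_invariant[THEN invariant_solution_if_invariant_under_symmetry]
  b_exp_invariant[THEN invariant_solution_if_invariant_under_symmetry]
  b_affine_invariant[THEN invariant_solution_if_invariant_under_symmetry]
  b_const_invariant_shift[THEN invariant_solution_if_invariant_under_symmetry]

lemma invariant_iff_classified: "invariant_solution 1 \<Omega> (u_sol b) \<longleftrightarrow> classified"
proof
  show "invariant_solution 1 \<Omega> (u_sol b)" if classified
    using that
    by (elim disjE exE) (erule invariant_forms)+
qed (rule classified_if_invariant)

end

theorem theorem2:
  fixes D :: "complex set" and b :: "complex \<Rightarrow> complex"
  assumes "open D" and "connected D" and "D \<noteq> {}"
    and "\<forall>z\<in>D. z + cnj z \<noteq> 0"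
    and "b holomorphic_on D"
  shows
    "heavenly_solution 1 (u_dom D b) (u_sol b) \<and>
     (noninvariant_solution 1 (u_dom D b) (u_sol b) \<longleftrightarrow>
        \<not> ((\<exists>\<alpha> \<beta> lam C1 C2 \<nu> C. b_power_quadratic D b \<alpha> \<beta> lam C1 C2 \<nu> C) \<or>
           (\<exists>\<alpha> lam C1 C2 \<nu> C. b_log_quadratic D b \<alpha> lam C1 C2 \<nu> C) \<or>
           (\<exists>\<alpha> \<beta> lam C1 C. b_exp_pole D b \<alpha> \<beta> lam C1 C) \<or>
           (\<exists>\<alpha> lam C1 C. b_pole D b \<alpha> lam C1 C) \<or>
           (\<exists>\<alpha> \<beta> C1 C2 C. b_power_linear D b \<alpha> \<beta> C1 C2 C) \<or>
           (\<exists>\<alpha> C1 C2 C. b_log_linear D b \<alpha> C1 C2 C) \<or>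
           (\<exists>\<alpha> \<beta> C2 C. b_exp D b \<alpha> \<beta> C2 C) \<or>
           (\<exists>\<alpha> C2 C. b_affine D b \<alpha> C2 C) \<or>
           (\<exists>c. b_const D b c))) \<and>
     (\<forall>\<alpha> \<beta> lam C1 C2 \<nu> C. b_power_quadratic D b \<alpha> \<beta> lam C1 C2 \<nu> C \<longrightarrow>
        invariant_under_symmetry (u_dom D b) (u_sol b) (X_quadratic \<alpha> \<beta> lam C1 C2)) \<and>
     (\<forall>\<alpha> lam C1 C2 \<nu> C. b_log_quadratic D b \<alpha> lam C1 C2 \<nu> C \<longrightarrow>
        invariant_under_symmetry (u_dom D b) (u_sol b) (X_quadratic \<alpha> 0 lam C1 C2)) \<and>
     (\<forall>\<alpha> \<beta> lam C1 C. b_exp_pole D b \<alpha> \<beta> lam C1 C \<longrightarrow>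
        invariant_under_symmetry (u_dom D b) (u_sol b) (X_quadratic \<alpha> \<beta> lam C1 0)) \<and>
     (\<forall>\<alpha> lam C1 C. b_pole D b \<alpha> lam C1 C \<longrightarrow>
        invariant_under_symmetry (u_dom D b) (u_sol b) (X_quadratic \<alpha> 0 lam C1 0)) \<and>
     (\<forall>\<alpha> \<beta> C1 C2 C. b_power_linear D b \<alpha> \<beta> C1 C2 C \<longrightarrow>
        invariant_under_symmetry (u_dom D b) (u_sol b) (X_linear \<alpha> \<beta> C1 C2)) \<and>
     (\<forall>\<alpha> C1 C2 C. b_log_linear D b \<alpha> C1 C2 C \<longrightarrow>
        invariant_under_symmetry (u_dom D b) (u_sol b) (X_linear \<alpha> 0 C1 C2)) \<and>
     (\<forall>\<alpha> \<beta> C2 C. b_exp D b \<alpha> \<beta> C2 C \<longrightarrow>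
        invariant_under_symmetry (u_dom D b) (u_sol b) (X_linear \<alpha> \<beta> 0 C2)) \<and>
     (\<forall>\<alpha> C2 C. b_affine D b \<alpha> C2 C \<longrightarrow>
        invariant_under_symmetry (u_dom D b) (u_sol b) (X_linear \<alpha> 0 0 C2)) \<and>
     (\<forall>c. b_const D b c \<longrightarrow>
        invariant_under_symmetry (u_dom D b) (u_sol b) X_shift \<and>
        (\<forall>\<alpha> \<beta>. \<beta> \<noteq> 0 \<and> c = of_real (\<alpha> / \<beta>) \<longrightarrow>
           invariant_under_symmetry (u_dom D b) (u_sol b) (X_linear \<alpha> \<beta> 0 0)))"
proof -
  interpret liouville_solution D b
    using assms by unfold_locales (auto simp: complex_eq_iff)
  show ?thesis
    unfolding noninvariant_solution_def invariant_iff_classified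
    by (intro conjI allI impI heavenly_u_sol iffI;
        (elim conjE)?; (assumption)?; (hypsubst)?;
        (rule b_power_quadratic_invariant b_log_quadratic_invariant b_exp_pole_invariant b_pole_invariant
          b_power_linear_invariant b_log_linear_invariant b_exp_invariant b_affine_invariant
          b_const_invariant_shift b_const_invariant_scaling)?; assumption?)
qed

end
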